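(* Let $X_1,\dots,X_n$ be i.i.d. random vectors in $\mathbb{R}^d$ with the mixed normal distribution: conditionally on $\{Z_i\}$, $X_i\sim\mathcal N(0,Z_iZ_i^T)$, where $Z_1,\dots,Z_n$ are i.i.d. $\mathcal N(0,I_d)$. Let $S_n=n^{-1/2}\sum_{i=1}^nX_i$ and $Z\sim\mathcal N(0,I_d)$. If $d\to\infty$ such that $d/n\to0$ as $n\to\infty$, then $$\Delta_{\mathscr B}(S_n,Z)\ge\Delta_L(\|S_n\|^2,\|Z\|^2)=O(d^{3/2}/n).$$
   Context: $\|\cdot\|$ is the Euclidean norm. $\Delta_{\mathscr{B}}(X,Y)=\sup_{r\ge0,\,t\in\mathbb{R}^d}|\mathbb{P}(\|X-t\|\le r)-\mathbb{P}(\|Y-t\|\le r)|$. $\Delta_L(X,Y)=\inf\{\varepsilon>0:G(x-\varepsilon)-\varepsilon\le F(x)\le G(x+\varepsilon)+\varepsilon\text{ for all }x\in\mathbb{R}\}$ is the Lévy distance between the c.d.f.s $F$ of $X$ and $G$ of $Y$. *)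

theory Defs
  imports "HOL-Probability.Probability" "HOL-Library.Landau_Symbols"
begin

text \<open>
  The dimension varies with the sample size, so a vector of \<open>\<real>\<^sup>d\<close> is a function
  \<^typ>\<open>nat \<Rightarrow> real\<close> with coordinates \<open>{..<d}\<close>, lying in the product space below (hence
  \<^const>\<open>undefined\<close> off \<open>{..<d}\<close>); its Euclidean norm is \<open>L2_set x {..<d}\<close>.
\<close>

definition borel_vec :: "nat \<Rightarrow> (nat \<Rightarrow> real) measure" where
  "borel_vec d = Pi\<^sub>M {..<d} (\<lambda>_. borel)"

definition vec_norm :: "nat \<Rightarrow> (nat \<Rightarrow> real) \<Rightarrow> real" where
  "vec_norm d x = L2_set x {..<d}"

definition has_law :: "'a measure \<Rightarrow> 'b measure \<Rightarrow> ('a \<Rightarrow> 'b) \<Rightarrow> 'b measure \<Rightarrow> bool" where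
  "has_law M N X \<mu> \<longleftrightarrow> X \<in> M \<rightarrow>\<^sub>M N \<and> distr M N X = \<mu>"

definition iid_vars :: "'a measure \<Rightarrow> 'b measure \<Rightarrow> ('i \<Rightarrow> 'a \<Rightarrow> 'b) \<Rightarrow> 'i set \<Rightarrow> bool" where
  "iid_vars M N X I \<longleftrightarrow>
     prob_space.indep_vars M (\<lambda>_. N) X I \<and>
     (\<forall>i\<in>I. \<forall>j\<in>I. distr M N (X i) = distr M N (X j))"

text \<open>\<open>\<N>(0, I\<^sub>d)\<close>\<close>

definition std_normal_vec :: "nat \<Rightarrow> (nat \<Rightarrow> real) measure" where
  "std_normal_vec d = distr (Pi\<^sub>M {..<d} (\<lambda>_. std_normal_distribution)) (borel_vec d) (\<lambda>x. x)"

text \<open>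
  \<open>\<mu> = \<N>(0, \<Sigma>)\<close>, with \<open>\<Sigma>\<close> possibly singular: \<open>\<mu>\<close> is the law of \<open>A \<xi>\<close> for a standard normal
  vector \<open>\<xi>\<close> in \<open>\<real>\<^sup>k\<close> and a \<open>d \<times> k\<close> matrix \<open>A\<close> with \<open>A A\<^sup>T = \<Sigma>\<close>.  The law does not depend on
  the choice of \<open>k\<close> and \<open>A\<close>.
\<close>

definition centered_normal ::
    "nat \<Rightarrow> (nat \<Rightarrow> nat \<Rightarrow> real) \<Rightarrow> (nat \<Rightarrow> real) measure \<Rightarrow> bool" where
  "centered_normal d \<Sigma> \<mu> \<longleftrightarrow>
     (\<exists>k A. (\<forall>i<d. \<forall>j<d. \<Sigma> i j = (\<Sum>l<k. A i l * A j l)) \<and>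
        \<mu> = distr (std_normal_vec k) (borel_vec d) (\<lambda>\<xi>. \<lambda>i\<in>{..<d}. \<Sum>l<k. A i l * \<xi> l))"

definition sigma_gen :: "'a measure \<Rightarrow> 'b measure \<Rightarrow> ('i \<Rightarrow> 'a \<Rightarrow> 'b) \<Rightarrow> 'i set \<Rightarrow> 'a measure" where
  "sigma_gen M N Z I = vimage_algebra (space M) (\<lambda>\<omega>. \<lambda>i\<in>I. Z i \<omega>) (Pi\<^sub>M I (\<lambda>_. N))"

text \<open>
  \<open>\<kappa> \<omega>\<close> is a version of the conditional law of \<open>X\<close> given the sub-\<open>\<sigma>\<close>-algebra \<open>F\<close>;
  that \<open>\<omega> \<mapsto> \<kappa> \<omega> B\<close> is \<open>F\<close>-measurable is implied up to null sets by the last conjunct.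
\<close>

definition has_cond_law ::
    "'a measure \<Rightarrow> 'a measure \<Rightarrow> 'b measure \<Rightarrow> ('a \<Rightarrow> 'b) \<Rightarrow> ('a \<Rightarrow> 'b measure) \<Rightarrow> bool" where
  "has_cond_law M F N X \<kappa> \<longleftrightarrow>
     X \<in> M \<rightarrow>\<^sub>M N \<and>
     (\<forall>\<omega>\<in>space M. prob_space (\<kappa> \<omega>) \<and> sets (\<kappa> \<omega>) = sets N) \<and>
     (\<forall>B\<in>sets N. AE \<omega> in M.
        real_cond_exp M F (indicator (X -` B \<inter> space M)) \<omega> = measure (\<kappa> \<omega>) B)"

text \<open>
  \<open>X\<^sub>1, \<dots>, X\<^sub>n\<close> are i.i.d. and, conditionally on the whole family \<open>Z\<^sub>1, \<dots>, Z\<^sub>n\<close> of i.i.d.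
  standard normal vectors, \<open>X\<^sub>i\<close> has law \<open>\<N>(0, Z\<^sub>i Z\<^sub>i\<^sup>T)\<close>.
\<close>

definition mixed_normal_sample ::
    "'a measure \<Rightarrow> nat \<Rightarrow> nat \<Rightarrow> (nat \<Rightarrow> 'a \<Rightarrow> nat \<Rightarrow> real) \<Rightarrow> (nat \<Rightarrow> 'a \<Rightarrow> nat \<Rightarrow> real) \<Rightarrow> bool"
where
  "mixed_normal_sample M d n Z X \<longleftrightarrow>
     iid_vars M (borel_vec d) Z {1..n} \<and>
     (\<forall>i\<in>{1..n}. has_law M (borel_vec d) (Z i) (std_normal_vec d)) \<and>
     iid_vars M (borel_vec d) X {1..n} \<and>
     (\<forall>i\<in>{1..n}. \<exists>\<kappa>.
        (\<forall>\<omega>\<in>space M. centered_normal d (\<lambda>a b. Z i \<omega> a * Z i \<omega> b) (\<kappa> \<omega>)) \<and>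
        has_cond_law M (sigma_gen M (borel_vec d) Z {1..n}) (borel_vec d) (X i) \<kappa>)"

definition normalized_sum ::
    "nat \<Rightarrow> nat \<Rightarrow> (nat \<Rightarrow> 'a \<Rightarrow> nat \<Rightarrow> real) \<Rightarrow> 'a \<Rightarrow> nat \<Rightarrow> real" where
  "normalized_sum d n X \<omega> = (\<lambda>j\<in>{..<d}. (\<Sum>i=1..n. X i \<omega> j) / sqrt (real n))"

text \<open>
  The two distances depend only on the laws of the variables, which may live on different spaces.
\<close>

definition ball_dist ::
    "nat \<Rightarrow> 'a measure \<Rightarrow> ('a \<Rightarrow> nat \<Rightarrow> real) \<Rightarrow> 'b measure \<Rightarrow> ('b \<Rightarrow> nat \<Rightarrow> real) \<Rightarrow> real" where
  "ball_dist d M X N Y =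
     (SUP (r, t) \<in> {0..} \<times> space (borel_vec d).
        \<bar>measure M {\<omega> \<in> space M. vec_norm d (\<lambda>j. X \<omega> j - t j) \<le> r} -
         measure N {\<omega> \<in> space N. vec_norm d (\<lambda>j. Y \<omega> j - t j) \<le> r}\<bar>)"

definition levy_dist ::
    "'a measure \<Rightarrow> ('a \<Rightarrow> real) \<Rightarrow> 'b measure \<Rightarrow> ('b \<Rightarrow> real) \<Rightarrow> real" where
  "levy_dist M X N Y =
     (let F = cdf (distr M borel X); G = cdf (distr N borel Y) in
      Inf {\<epsilon>. \<epsilon> > 0 \<and> (\<forall>x. G (x - \<epsilon>) - \<epsilon> \<le> F x \<and> F x \<le> G (x + \<epsilon>) + \<epsilon>)})"

end

theory Submission
  imports Defs
begin

text \<open>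
  A centered normal law with covariance \<open>z z\<^sup>T\<close> is the law of \<open>\<eta> z\<close> with a scalar standard
  normal \<open>\<eta>\<close>.  Conditionally on the scalars \<open>\<eta>\<^sub>1, \<dots>, \<eta>\<^sub>n\<close>, the vector \<open>S\<^sub>n\<close> is therefore
  distributed as \<open>sqrt V\<close> times a standard normal vector, where \<open>V = (\<Sum>\<eta>\<^sub>i\<^sup>2) / n\<close> has mean 1 and
  variance \<open>2 / n\<close>.  With \<open>g v\<close> the probability of \<open>v \<parallel>Z\<parallel>\<^sup>2 \<le> x\<close>, the distribution functions
  to be compared are \<open>E (g V)\<close> and \<open>g 1\<close>.  Expanding the likelihood ratio of \<open>N(0, v I)\<close> against
  \<open>N(0, I)\<close> to first order in \<open>v - 1\<close>, with the remainder controlled in \<open>L\<^sup>2\<close>, gives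
  \<open>g v = g 1 + c (v - 1) + O(d (v - 1)\<^sup>2)\<close> uniformly in \<open>x\<close> and \<open>v \<ge> 0\<close>.  Integrating over \<open>V\<close>,
  the linear term vanishes and even the Kolmogorov distance is at most \<open>8 d / n\<close>.
\<close>

subsection \<open>Gaussian product measures\<close>

abbreviation std_normal_PiM :: "'i set \<Rightarrow> ('i \<Rightarrow> real) measure" where
  "std_normal_PiM J \<equiv> Pi\<^sub>M J (\<lambda>_. std_normal_distribution)"

interpretation std_normal: prob_space std_normal_distribution
  by (rule prob_space_normal_density) simp

lemma prob_space_std_normal_PiM: "prob_space (std_normal_PiM J)"
  by (intro prob_space_PiM std_normal.prob_space_axioms)

lemma sets_std_normal_PiM: "sets (std_normal_PiM {..<d}) = sets (borel_vec d)"
  unfolding borel_vec_def by (rule sets_PiM_cong) simp_all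

lemma std_normal_vec_eq: "std_normal_vec d = std_normal_PiM {..<d}"
  unfolding std_normal_vec_def by (rule distr_id2) (simp add: sets_std_normal_PiM)

text \<open>Boxes determine a product measure. Fixing the first argument turns the preimage of a box
  into a box, whose measure is a product over the indices, and Fubini then applies index by index.
  The lemma serves twice: to reduce a sum of Gaussian vectors to single coordinates, and to separate
  the scalar factors of the sample from the vectors.\<close>

lemma distr_pair_PiM:
  assumes fin: "finite I" and M: "prob_space M" and N: "prob_space N"
    and f: "f \<in> M \<Otimes>\<^sub>M N \<rightarrow>\<^sub>M K"
  shows "distr (Pi\<^sub>M I (\<lambda>_. M) \<Otimes>\<^sub>M Pi\<^sub>M I (\<lambda>_. N)) (Pi\<^sub>M I (\<lambda>_. K))
           (\<lambda>(x, y). \<lambda>i\<in>I. f (x i, y i)) = Pi\<^sub>M I (\<lambda>_. distr (M \<Otimes>\<^sub>M N) K f)"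
    (is "distr (?PM \<Otimes>\<^sub>M ?PN) ?PK ?f = Pi\<^sub>M I (\<lambda>_. ?D)")
proof -
  interpret M: prob_space M by fact
  interpret N: prob_space N by fact
  interpret MN: pair_prob_space M N ..
  interpret D: prob_space ?D using f by (rule MN.prob_space_distr)
  interpret PN': prob_space ?PN by (intro prob_space_PiM N)
  interpret PM: product_prob_space "\<lambda>_. M" by (rule product_prob_spaceI) (rule M)
  interpret PN: product_prob_space "\<lambda>_. N" by (rule product_prob_spaceI) (rule N)
  interpret PD: product_prob_space "\<lambda>_. ?D" by (rule product_prob_spaceI) (rule D.prob_space_axioms)
  note f[measurable]
  have F[measurable]: "?f \<in> ?PM \<Otimes>\<^sub>M ?PN \<rightarrow>\<^sub>M ?PK" by measurable
  show ?thesis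
  proof (rule PD.PiM_eqI[OF fin])
    show "sets (distr (?PM \<Otimes>\<^sub>M ?PN) ?PK ?f) = sets (Pi\<^sub>M I (\<lambda>_. ?D))"
      by (simp, rule sets_PiM_cong) simp_all
  next
    fix A assume A: "\<And>i. i \<in> I \<Longrightarrow> A i \<in> sets ?D"
    have A': "i \<in> I \<Longrightarrow> A i \<in> sets K" for i using A by simp
    define B where "B i = f -` A i \<inter> space (M \<Otimes>\<^sub>M N)" for i
    have B[measurable]: "i \<in> I \<Longrightarrow> B i \<in> sets (M \<Otimes>\<^sub>M N)" for i
      unfolding B_def using measurable_sets[OF f] A' by simp
    let ?E = "?f -` (Pi\<^sub>E I A) \<inter> space (?PM \<Otimes>\<^sub>M ?PN)"
    have PiA: "Pi\<^sub>E I A \<in> sets ?PK" using A' fin by (intro sets_PiM_I_finite) auto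
    have E: "?E \<in> sets (?PM \<Otimes>\<^sub>M ?PN)" using measurable_sets[OF F PiA] .
    have "emeasure (distr (?PM \<Otimes>\<^sub>M ?PN) ?PK ?f) (Pi\<^sub>E I A) = emeasure (?PM \<Otimes>\<^sub>M ?PN) ?E"
      by (rule emeasure_distr[OF F PiA])
    also have "\<dots> = (\<integral>\<^sup>+x. emeasure ?PN (Pair x -` ?E) \<partial>?PM)"
      by (rule PN'.emeasure_pair_measure_alt[OF E])
    also have "\<dots> = (\<integral>\<^sup>+x. (\<Prod>i\<in>I. emeasure N (Pair (x i) -` B i)) \<partial>?PM)"
    proof (rule nn_integral_cong)
      fix x assume x: "x \<in> space ?PM"
      have "Pair x -` ?E = Pi\<^sub>E I (\<lambda>i. Pair (x i) -` B i)"
        using x unfolding B_def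
        by (auto simp: space_pair_measure space_PiM PiE_iff fun_eq_iff extensional_def)
      then show "emeasure ?PN (Pair x -` ?E) = (\<Prod>i\<in>I. emeasure N (Pair (x i) -` B i))"
        using fin by (simp add: PN.emeasure_PiM sets_Pair1)
    qed
    also have "\<dots> = (\<Prod>i\<in>I. \<integral>\<^sup>+x. emeasure N (Pair x -` B i) \<partial>M)"
      by (rule PM.product_nn_integral_prod[OF fin]) (rule N.measurable_emeasure_Pair, rule B)
    also have "\<dots> = (\<Prod>i\<in>I. emeasure ?D (A i))"
      using A' by (intro prod.cong) (simp_all add: N.emeasure_pair_measure_alt B_def[symmetric] emeasure_distr[OF f])
    finally show "emeasure (distr (?PM \<Otimes>\<^sub>M ?PN) ?PK ?f) (Pi\<^sub>E I A) = (\<Prod>i\<in>I. emeasure ?D (A i))" .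
  qed
qed

lemma char_distr_scale:
  "char (distr std_normal_distribution borel (\<lambda>x. c * x)) t = exp (- ((c * t)\<^sup>2) / 2)"
proof -
  have "char (distr std_normal_distribution borel (\<lambda>x. c * x)) t = char std_normal_distribution (c * t)"
    unfolding char_def by (subst integral_distr) (auto simp: mult_ac)
  then show ?thesis by (simp add: char_std_normal_distribution flip: exp_of_real)
qed

lemma real_distribution_distr:
  assumes "prob_space M" "f \<in> borel_measurable M"
  shows "real_distribution (distr M borel f)"
  using prob_space.prob_space_distr[OF assms]
  by (simp add: real_distribution_def real_distribution_axioms_def)

text \<open>Compare characteristic functions: by independence the exponential factorises, and the
  exponents add up. Writing the right side as a scaled standard normal, not through a density, also
  covers the degenerate case where all coefficients vanish.\<close>

lemma distr_std_normal_linear: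
  fixes J :: "'i set" assumes fin: "finite J"
  shows "distr (std_normal_PiM J) borel (\<lambda>\<xi>. \<Sum>l\<in>J. u l * \<xi> l) =
         distr std_normal_distribution borel (\<lambda>x. sqrt (\<Sum>l\<in>J. (u l)\<^sup>2) * x)"
proof (rule Levy_uniqueness)
  interpret P: product_prob_space "\<lambda>_::'i. std_normal_distribution"
    by (rule product_prob_spaceI) (rule std_normal.prob_space_axioms)
  interpret PJ: prob_space "std_normal_PiM J" by (rule prob_space_std_normal_PiM)
  have m[measurable]: "(\<lambda>\<xi>. \<Sum>l\<in>J. u l * \<xi> l) \<in> borel_measurable (std_normal_PiM J)"
  proof (rule borel_measurable_sum)
    fix l assume [measurable]: "l \<in> J"
    have "(\<lambda>\<xi>. \<xi> l) \<in> std_normal_PiM J \<rightarrow>\<^sub>M std_normal_distribution" by measurable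
    then have [measurable]: "(\<lambda>\<xi>. \<xi> l) \<in> std_normal_PiM J \<rightarrow>\<^sub>M borel" by simp
    show "(\<lambda>\<xi>. u l * \<xi> l) \<in> borel_measurable (std_normal_PiM J)" by measurable
  qed
  show "real_distribution (distr (std_normal_PiM J) borel (\<lambda>\<xi>. \<Sum>l\<in>J. u l * \<xi> l))"
    by (rule real_distribution_distr) (use prob_space_std_normal_PiM m in auto)
  show "real_distribution (distr std_normal_distribution borel (\<lambda>x. sqrt (\<Sum>l\<in>J. (u l)\<^sup>2) * x))"
    by (rule real_distribution_distr) (use std_normal.prob_space_axioms in auto)
  show "char (distr (std_normal_PiM J) borel (\<lambda>\<xi>. \<Sum>l\<in>J. u l * \<xi> l)) =
      char (distr std_normal_distribution borel (\<lambda>x. sqrt (\<Sum>l\<in>J. (u l)\<^sup>2) * x))"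
  proof
    fix t
    have "char (distr (std_normal_PiM J) borel (\<lambda>\<xi>. \<Sum>l\<in>J. u l * \<xi> l)) t =
        (CLINT \<xi>|std_normal_PiM J. \<Prod>l\<in>J. iexp (t * u l * \<xi> l))"
      unfolding char_def using fin
      by (subst integral_distr)
         (auto simp: sum_distrib_left mult_ac simp flip: exp_sum)
    also have "\<dots> = (\<Prod>l\<in>J. CLINT x|std_normal_distribution. iexp (t * u l * x))"
      by (rule P.product_integral_prod[OF fin])
         (rule std_normal.integrable_const_bound[where B=1], auto)
    also have "\<dots> = (\<Prod>l\<in>J. of_real (exp (- ((t * u l)\<^sup>2) / 2)))"
    proof (rule prod.cong)
      fix l
      show "(CLINT x|std_normal_distribution. iexp (t * u l * x)) = complex_of_real (exp (- ((t * u l)\<^sup>2) / 2))"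
        using char_std_normal_distribution[THEN fun_cong, of "t * u l"]
        unfolding char_def by simp
    qed simp
    also have "\<dots> = of_real (exp (\<Sum>l\<in>J. - ((t * u l)\<^sup>2) / 2))"
      using fin by (simp add: exp_sum)
    also have "(\<Sum>l\<in>J. - ((t * u l)\<^sup>2) / 2) = - ((sqrt (\<Sum>l\<in>J. (u l)\<^sup>2) * t)\<^sup>2) / 2"
      by (simp add: power_mult_distrib sum_nonneg sum_negf sum_divide_distrib sum_distrib_left mult_ac)
    finally show "char (distr (std_normal_PiM J) borel (\<lambda>\<xi>. \<Sum>l\<in>J. u l * \<xi> l)) t =
        char (distr std_normal_distribution borel (\<lambda>x. sqrt (\<Sum>l\<in>J. (u l)\<^sup>2) * x)) t"
      by (simp add: char_distr_scale)
  qed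
qed

text \<open>Stability of the normal law on a binary product, which is the form consumed by the
  induction over the number of vectors below.\<close>

lemma distr_pair_std_normal_linear:
  "distr (std_normal_distribution \<Otimes>\<^sub>M std_normal_distribution) borel (\<lambda>(x, y). a * x + b * y) =
   distr std_normal_distribution borel (\<lambda>x. sqrt (a\<^sup>2 + b\<^sup>2) * x)" (is "?L = ?R")
proof (rule Levy_uniqueness)
  let ?N = std_normal_distribution
  interpret NN: pair_prob_space ?N ?N ..
  have m[measurable]: "(\<lambda>(x, y). a * x + b * y) \<in> borel_measurable (?N \<Otimes>\<^sub>M ?N)"
    by (simp add: measurable_split_conv cong: measurable_cong_sets)
  show "real_distribution ?L"
    by (rule real_distribution_distr[OF NN.prob_space_axioms m])
  show "real_distribution ?R"
    by (rule real_distribution_distr[OF std_normal.prob_space_axioms]) simp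
  show "char ?L = char ?R"
  proof
    fix t
    have ch: "(CLINT x|?N. iexp (t * (c * x))) = of_real (exp (- ((c * t)\<^sup>2) / 2))" for c
      using char_std_normal_distribution[THEN fun_cong, of "t * c"]
      unfolding char_def by (simp add: mult_ac)
    have "char ?L t = (CLINT p|?N \<Otimes>\<^sub>M ?N. iexp (t * (a * fst p + b * snd p)))"
      unfolding char_def by (subst integral_distr) (auto simp: case_prod_beta)
    also have "\<dots> = (CLINT x|?N. CLINT y|?N. iexp (t * (a * fst (x, y) + b * snd (x, y))))"
    proof (rule NN.integral_fst'[symmetric])
      have "(\<lambda>p. iexp (t * (a * fst p + b * snd p))) \<in> borel_measurable (?N \<Otimes>\<^sub>M ?N)"
        by (simp add: measurable_split_conv cong: measurable_cong_sets)
      then show "integrable (?N \<Otimes>\<^sub>M ?N) (\<lambda>p. iexp (t * (a * fst p + b * snd p)))"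
        by (intro NN.integrable_const_bound[where B=1]) auto
    qed
    also have "\<dots> = (CLINT x|?N. CLINT y|?N. iexp (t * (a * x)) * iexp (t * (b * y)))"
      by (simp add: distrib_left exp_add)
    also have "\<dots> = (CLINT x|?N. iexp (t * (a * x))) * (CLINT y|?N. iexp (t * (b * y)))"
      by (simp only: integral_mult_right_zero integral_mult_left_zero)
    also have "\<dots> = of_real (exp (- ((a * t)\<^sup>2) / 2) * exp (- ((b * t)\<^sup>2) / 2))"
      by (simp only: ch) simp
    also have "exp (- ((a * t)\<^sup>2) / 2) * exp (- ((b * t)\<^sup>2) / 2) = exp (- ((sqrt (a\<^sup>2 + b\<^sup>2) * t)\<^sup>2) / 2)"
      by (simp add: power_mult_distrib field_simps flip: exp_add)
    finally show "char ?L t = char ?R t" by (simp add: char_distr_scale)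
  qed
qed

section \<open>Linear combinations of independent standard normal vectors\<close>

lemma distr_std_normal_PiM_scale:
  assumes "finite J"
  shows "distr (std_normal_PiM J) (std_normal_PiM J) (\<lambda>w. \<lambda>j\<in>J. c * w j) =
         Pi\<^sub>M J (\<lambda>_. distr std_normal_distribution std_normal_distribution (\<lambda>x. c * x))"
proof -
  have "(\<lambda>x. c * x) \<in> std_normal_distribution \<rightarrow>\<^sub>M std_normal_distribution"
    by (simp cong: measurable_cong_sets)
  moreover have "compose J (\<lambda>x. c * x) = (\<lambda>w. \<lambda>j\<in>J. c * w j)"
    by (simp add: fun_eq_iff compose_def)
  ultimately show ?thesis
    using distr_PiM_finite_prob_space'[OF assms, of "\<lambda>_. std_normal_distribution"
        "\<lambda>_. std_normal_distribution" "\<lambda>x. c * x"] std_normal.prob_space_axioms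
    by simp
qed

lemma measurable_std_normal_PiM_component:
  assumes "j \<in> J"
  shows "(\<lambda>x. x j) \<in> borel_measurable (std_normal_PiM J)"
proof -
  have "(\<lambda>x. x j) \<in> std_normal_PiM J \<rightarrow>\<^sub>M std_normal_distribution"
    using assms by (rule measurable_component_singleton)
  then show ?thesis by simp
qed

lemma measurable_into_std_normal_PiM:
  assumes "\<And>j. j \<in> J \<Longrightarrow> (\<lambda>x. f x j) \<in> borel_measurable M"
  shows "(\<lambda>x. \<lambda>j\<in>J. f x j) \<in> M \<rightarrow>\<^sub>M std_normal_PiM J"
  by (rule measurable_restrict) (use assms in simp)

lemma measurable_PiM_std_normal_PiM_component:
  assumes "i \<in> I" "j \<in> J"
  shows "(\<lambda>x. x i j) \<in> borel_measurable (Pi\<^sub>M I (\<lambda>_. std_normal_PiM J))"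
  using measurable_compose[OF measurable_component_singleton[OF assms(1)]
      measurable_std_normal_PiM_component[OF assms(2)]] .

text \<open>This is what makes the normalized sum a scaled standard normal vector once the scalars
  \<eta> are frozen. Induction on \<open>I\<close>: split off one vector, replace the remaining sum
  by a scaled standard normal vector, and merge the two coordinate by coordinate.\<close>

lemma distr_PiM_std_normal_PiM_linear:
  assumes J: "finite J" and I: "finite I"
  shows "distr (Pi\<^sub>M I (\<lambda>_. std_normal_PiM J)) (std_normal_PiM J) (\<lambda>z. \<lambda>j\<in>J. \<Sum>i\<in>I. \<eta> i * z i j) =
         distr (std_normal_PiM J) (std_normal_PiM J) (\<lambda>w. \<lambda>j\<in>J. sqrt (\<Sum>i\<in>I. (\<eta> i)\<^sup>2) * w j)"
  using I
proof (induction I rule: finite_induct)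
  case empty
  interpret prob_space "Pi\<^sub>M {} (\<lambda>_. std_normal_PiM J)"
    by (rule prob_space_PiM) (rule prob_space_std_normal_PiM)
  interpret P: prob_space "std_normal_PiM J" by (rule prob_space_std_normal_PiM)
  \<comment> \<open>Both laws are the point mass at the zero vector, since the sum and the scale are
    both 0.\<close>
  have "(\<lambda>j\<in>J. 0) \<in> space (std_normal_PiM J)" by (auto simp: space_PiM)
  then show ?case by (simp add: distr_const P.distr_const del: restrict_apply cong del: restrict_cong)
next
  case (insert i I)
  let ?N = "std_normal_distribution" and ?P = "std_normal_PiM J"
  let ?Q = "\<lambda>I. Pi\<^sub>M I (\<lambda>_. std_normal_PiM J)"
  let ?T = "\<lambda>I z. \<lambda>j\<in>J. \<Sum>i\<in>I. \<eta> i * z i j"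
  define G where "G = (\<lambda>(x, w). \<lambda>j\<in>J. \<eta> i * x j + w j)"
  define s where "s = (\<Sum>i\<in>I. (\<eta> i)\<^sup>2)"
  have s: "s \<ge> 0" unfolding s_def by (simp add: sum_nonneg)
  interpret P: prob_space ?P by (rule prob_space_std_normal_PiM)
  have T[measurable]: "?T K \<in> ?Q K \<rightarrow>\<^sub>M ?P" for K
    by (intro measurable_into_std_normal_PiM borel_measurable_sum borel_measurable_times
        measurable_PiM_std_normal_PiM_component) auto
  have G[measurable]: "G \<in> ?P \<Otimes>\<^sub>M ?P \<rightarrow>\<^sub>M ?P"
    unfolding G_def case_prod_beta
    by (intro measurable_into_std_normal_PiM borel_measurable_add borel_measurable_times
        measurable_compose[OF measurable_fst measurable_std_normal_PiM_component]
        measurable_compose[OF measurable_snd measurable_std_normal_PiM_component]) auto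
  have sc[measurable]: "(\<lambda>w. \<lambda>j\<in>J. c * w j) \<in> ?P \<rightarrow>\<^sub>M ?P" for c
    by (intro measurable_into_std_normal_PiM borel_measurable_times
        measurable_std_normal_PiM_component) auto
  have upd[measurable]: "(\<lambda>(x, X). X(i := x)) \<in> ?P \<Otimes>\<^sub>M ?Q I \<rightarrow>\<^sub>M ?Q (insert i I)"
    by measurable
  have lin[measurable]: "(\<lambda>(x, y). \<eta> i * x + sqrt s * y) \<in> ?N \<Otimes>\<^sub>M ?N \<rightarrow>\<^sub>M ?N"
    by (simp add: measurable_split_conv cong: measurable_cong_sets)
  have "distr (?Q (insert i I)) ?P (?T (insert i I)) =
      distr (distr (?P \<Otimes>\<^sub>M ?Q I) (?Q (insert i I)) (\<lambda>(x, X). X(i := x))) ?P (?T (insert i I))"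
    by (simp add: distr_pair_PiM_eq_PiM[of I "\<lambda>_. ?P"] prob_space_std_normal_PiM)
  also have "\<dots> = distr (?P \<Otimes>\<^sub>M ?Q I) ?P (?T (insert i I) \<circ> (\<lambda>(x, X). X(i := x)))"
    by (rule distr_distr[OF T upd])
  also have "?T (insert i I) \<circ> (\<lambda>(x, X). X(i := x)) = G \<circ> (\<lambda>(x, X). (x, ?T I X))"
  proof -
    have "(\<Sum>k\<in>I. \<eta> k * (if k = i then x else X k) j) = (\<Sum>k\<in>I. \<eta> k * X k j)" for x X j
      using insert.hyps by (intro sum.cong) auto
    then show ?thesis
      using insert.hyps by (auto simp: G_def fun_eq_iff intro!: restrict_ext)
  qed
  also have "distr (?P \<Otimes>\<^sub>M ?Q I) ?P (G \<circ> (\<lambda>(x, X). (x, ?T I X))) =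
      distr (distr (?P \<Otimes>\<^sub>M ?Q I) (?P \<Otimes>\<^sub>M ?P) (\<lambda>(x, X). (x, ?T I X))) ?P G"
    by (rule distr_distr[symmetric]) (use T in measurable)
  \<comment> \<open>The new vector is independent of the partial sum, so the joint law is a product,
    and the induction hypothesis can be substituted in its second factor.\<close>
  also have "distr (?P \<Otimes>\<^sub>M ?Q I) (?P \<Otimes>\<^sub>M ?P) (\<lambda>(x, X). (x, ?T I X)) =
      distr ?P ?P (\<lambda>x. x) \<Otimes>\<^sub>M distr (?Q I) ?P (?T I)"
  proof (rule pair_measure_distr[symmetric])
    interpret Q: prob_space "?Q I" by (intro prob_space_PiM prob_space_std_normal_PiM)
    interpret D: prob_space "distr (?Q I) ?P (?T I)" using T by (rule Q.prob_space_distr)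
    show "sigma_finite_measure (distr (?Q I) ?P (?T I))" ..
  qed (use T in measurable)
  also have "distr (?Q I) ?P (?T I) = distr ?P ?P (\<lambda>w. \<lambda>j\<in>J. sqrt s * w j)"
    unfolding s_def by (rule insert.IH)
  also have "distr ?P ?P (\<lambda>x. x) \<Otimes>\<^sub>M distr ?P ?P (\<lambda>w. \<lambda>j\<in>J. sqrt s * w j) =
      distr (?P \<Otimes>\<^sub>M ?P) (?P \<Otimes>\<^sub>M ?P) (\<lambda>(x, w). (x, \<lambda>j\<in>J. sqrt s * w j))"
  proof (rule pair_measure_distr)
    interpret D: prob_space "distr ?P ?P (\<lambda>w. \<lambda>j\<in>J. sqrt s * w j)" using sc by (rule P.prob_space_distr)
    show "sigma_finite_measure (distr ?P ?P (\<lambda>w. \<lambda>j\<in>J. sqrt s * w j))" ..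
  qed (use sc in measurable)
  also have "distr \<dots> ?P G = distr (?P \<Otimes>\<^sub>M ?P) ?P (G \<circ> (\<lambda>(x, w). (x, \<lambda>j\<in>J. sqrt s * w j)))"
    by (rule distr_distr) (use sc in measurable)
  \<comment> \<open>Coordinate \<open>j\<close> of the result depends only on coordinate
    \<open>j\<close> of the two vectors, so the law is again a product and one coordinate remains to
    be computed.\<close>
  also have "G \<circ> (\<lambda>(x, w). (x, \<lambda>j\<in>J. sqrt s * w j)) =
      (\<lambda>(x, y). \<lambda>j\<in>J. (\<lambda>(x, y). \<eta> i * x + sqrt s * y) (x j, y j))"
    by (auto simp: G_def fun_eq_iff)
  also have "distr (?P \<Otimes>\<^sub>M ?P) ?P \<dots> =
      Pi\<^sub>M J (\<lambda>_. distr (?N \<Otimes>\<^sub>M ?N) ?N (\<lambda>(x, y). \<eta> i * x + sqrt s * y))"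
    by (rule distr_pair_PiM[OF J std_normal.prob_space_axioms std_normal.prob_space_axioms lin])
  also have "distr (?N \<Otimes>\<^sub>M ?N) ?N (\<lambda>(x, y). \<eta> i * x + sqrt s * y) =
      distr (?N \<Otimes>\<^sub>M ?N) borel (\<lambda>(x, y). \<eta> i * x + sqrt s * y)"
    by (rule distr_cong) auto
  also have "\<dots> = distr ?N borel (\<lambda>x. sqrt ((\<eta> i)\<^sup>2 + (sqrt s)\<^sup>2) * x)"
    by (rule distr_pair_std_normal_linear)
  also have "\<dots> = distr ?N ?N (\<lambda>x. sqrt (\<Sum>i\<in>insert i I. (\<eta> i)\<^sup>2) * x)"
    using insert.hyps s by (intro distr_cong) (auto simp: s_def)
  also have "Pi\<^sub>M J (\<lambda>_. \<dots>) = distr ?P ?P (\<lambda>w. \<lambda>j\<in>J. sqrt (\<Sum>i\<in>insert i I. (\<eta> i)\<^sup>2) * w j)"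
    by (rule distr_std_normal_PiM_scale[OF J, symmetric])
  finally show ?case .
qed

text \<open>\<open>centered_normal\<close> leaves \<open>k\<close> and \<open>A\<close> free, but
  \<open>A A^T = z z^T\<close> forces all rows of \<open>A\<close> to be multiples of one vector:
  \<open>A i l = z i * u l\<close>, with \<open>u\<close> of norm 1 unless \<open>z\<close>
  vanishes. So \<open>A\<close> maps a standard normal vector to \<open>z\<close> times its scalar
  product with \<open>u\<close>, which is a standard normal scalar.\<close>

lemma centered_normal_rank_one:
  assumes "centered_normal d (\<lambda>a b. z a * z b) \<mu>"
  shows "\<mu> = distr std_normal_distribution (borel_vec d) (\<lambda>e. \<lambda>i\<in>{..<d}. e * z i)"
proof -
  let ?N = "std_normal_distribution"
  obtain k A where A: "\<And>i j. i < d \<Longrightarrow> j < d \<Longrightarrow> z i * z j = (\<Sum>l<k. A i l * A j l)"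
    and \<mu>: "\<mu> = distr (std_normal_vec k) (borel_vec d) (\<lambda>\<xi>. \<lambda>i\<in>{..<d}. \<Sum>l<k. A i l * \<xi> l)"
    using assms unfolding centered_normal_def by blast
  obtain u where u: "\<And>i l. i < d \<Longrightarrow> l < k \<Longrightarrow> A i l = z i * u l"
    and u1: "(\<Sum>l<k. (u l)\<^sup>2) = 1 \<or> (\<forall>i<d. z i = 0)"
  proof (cases "\<forall>i<d. z i = 0")
    case True
    \<comment> \<open>The diagonal of \<open>A A^T\<close> is zero, which kills \<open>A\<close>;
      any \<open>u\<close> then does.\<close>
    have "A i l = 0" if "i < d" "l < k" for i l
    proof -
      have "(\<Sum>l<k. (A i l)\<^sup>2) = 0"
        using A[OF that(1) that(1)] that True by (simp add: power2_eq_square)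
      then show ?thesis using that by (simp add: sum_nonneg_eq_0_iff)
    qed
    with True show ?thesis by (intro that[of "\<lambda>_. 0"]) auto
  next
    case False
    then obtain a where a: "a < d" "z a \<noteq> 0" by blast
    \<comment> \<open>Any row with \<open>z a\<close> nonzero reveals the common direction.\<close>
    define u where "u l = A a l / z a" for l
    have "(\<Sum>l<k. (u l)\<^sup>2) = (\<Sum>l<k. A a l * A a l) / (z a * z a)"
      unfolding u_def by (simp add: sum_divide_distrib power_divide power2_eq_square)
    then have u2: "(\<Sum>l<k. (u l)\<^sup>2) = 1" using a by (simp add: A[symmetric])
    have "A i l = z i * u l" if i: "i < d" and l: "l < k" for i l
    proof -
      \<comment> \<open>Inserting the entries of \<open>A A^T\<close>, the three terms become
        \<open>(z i)^2 - 2 (z i)^2 + (z i)^2\<close>.\<close>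
      have "(\<Sum>l<k. (A i l - z i * u l)\<^sup>2) =
          (\<Sum>l<k. A i l * A i l) - 2 * z i / z a * (\<Sum>l<k. A i l * A a l) + (z i)\<^sup>2 * (\<Sum>l<k. (u l)\<^sup>2)"
        unfolding u_def
        by (simp add: sum_distrib_left power2_eq_square algebra_simps flip: sum.distrib sum_subtractf)
      also have "\<dots> = 0" using a i u2 by (simp add: A[symmetric] power2_eq_square)
      finally have "(\<Sum>l<k. (A i l - z i * u l)\<^sup>2) = 0" .
      then show ?thesis using l by (simp add: sum_nonneg_eq_0_iff)
    qed
    with u2 show ?thesis by (intro that[of u]) auto
  qed
  have scale: "(\<lambda>e. \<lambda>i\<in>{..<d}. e * z i) \<in> borel \<rightarrow>\<^sub>M borel_vec d"
    unfolding borel_vec_def by measurable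
  have lin: "(\<lambda>\<xi>. \<Sum>l<k. u l * \<xi> l) \<in> std_normal_PiM {..<k} \<rightarrow>\<^sub>M borel"
    by (intro borel_measurable_sum borel_measurable_times measurable_std_normal_PiM_component) auto
  have "(\<lambda>\<xi>. \<lambda>i\<in>{..<d}. \<Sum>l<k. A i l * \<xi> l) = (\<lambda>e. \<lambda>i\<in>{..<d}. e * z i) \<circ> (\<lambda>\<xi>. \<Sum>l<k. u l * \<xi> l)"
    by (auto simp: fun_eq_iff u sum_distrib_left mult_ac)
  then have "\<mu> = distr (distr (std_normal_PiM {..<k}) borel (\<lambda>\<xi>. \<Sum>l<k. u l * \<xi> l)) (borel_vec d)
      (\<lambda>e. \<lambda>i\<in>{..<d}. e * z i)"
    unfolding \<mu> std_normal_vec_eq by (simp add: distr_distr[OF scale lin])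
  also have "\<dots> = distr (distr ?N borel (\<lambda>x. sqrt (\<Sum>l<k. (u l)\<^sup>2) * x)) (borel_vec d)
      (\<lambda>e. \<lambda>i\<in>{..<d}. e * z i)"
    by (subst distr_std_normal_linear) simp_all
  also have "\<dots> = distr ?N (borel_vec d) ((\<lambda>e. \<lambda>i\<in>{..<d}. e * z i) \<circ> (\<lambda>x. sqrt (\<Sum>l<k. (u l)\<^sup>2) * x))"
    by (rule distr_distr[OF scale]) simp
  \<comment> \<open>Either the scale is 1, or all coordinates of \<open>z\<close> vanish and the
    scale does not matter.\<close>
  also have "(\<lambda>e. \<lambda>i\<in>{..<d}. e * z i) \<circ> (\<lambda>x. sqrt (\<Sum>l<k. (u l)\<^sup>2) * x) = (\<lambda>e. \<lambda>i\<in>{..<d}. e * z i)"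
    using u1 by (auto simp: fun_eq_iff)
  finally show ?thesis .
qed

subsection \<open>Second-order expansion in the scale\<close>

text \<open>It plays two roles. Over the coordinates of a vector, half of it is the derivative at
  \<open>v = 1\<close> of the log-likelihood ratio of N(0, v I) against N(0, I). Over the sample
  indices it is \<open>n (V - 1)\<close>.\<close>

definition centered_square_sum :: "'i set \<Rightarrow> ('i \<Rightarrow> real) \<Rightarrow> real" where
  "centered_square_sum J z = (\<Sum>j\<in>J. (z j)\<^sup>2 - 1)"

lemma measure_std_normal_UNIV [simp]: "measure std_normal_distribution UNIV = 1"
  using std_normal.prob_space unfolding space_density space_lborel space_borel .

lemma std_normal_centered_square:
  "integrable std_normal_distribution (\<lambda>x. x\<^sup>2 - 1)"
  "integral\<^sup>L std_normal_distribution (\<lambda>x. x\<^sup>2 - 1) = 0"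
  "integrable std_normal_distribution (\<lambda>x. (x\<^sup>2 - 1) * (x\<^sup>2 - 1))"
  "integral\<^sup>L std_normal_distribution (\<lambda>x. (x\<^sup>2 - 1) * (x\<^sup>2 - 1)) = 2"
proof -
  let ?N = "std_normal_distribution"
  have i[simp]: "integrable ?N (\<lambda>x. x ^ k)" for k by (rule integrable_std_normal_distribution_moment)
  have m: "integral\<^sup>L ?N (\<lambda>x. x\<^sup>2) = 1" "integral\<^sup>L ?N (\<lambda>x. x ^ 4) = 3"
    using std_normal_distribution_even_moments(1)[of 1] std_normal_distribution_even_moments(1)[of 2]
    by (simp_all add: fact_numeral)
  have one: "integral\<^sup>L ?N (\<lambda>x. c) = c" for c :: real by simp
  have e: "(\<lambda>x::real. (x\<^sup>2 - 1) * (x\<^sup>2 - 1)) = (\<lambda>x. x ^ 4 - 2 * x\<^sup>2 + 1)"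
    by (simp add: fun_eq_iff algebra_simps power4_eq_xxxx power2_eq_square)
  show "integrable ?N (\<lambda>x. x\<^sup>2 - 1)" by simp
  show "integral\<^sup>L ?N (\<lambda>x. x\<^sup>2 - 1) = 0" by (simp add: m one)
  show "integrable ?N (\<lambda>x. (x\<^sup>2 - 1) * (x\<^sup>2 - 1))" unfolding e by simp
  show "integral\<^sup>L ?N (\<lambda>x. (x\<^sup>2 - 1) * (x\<^sup>2 - 1)) = 2" unfolding e by (simp add: m one)
qed

lemma measurable_centered_square_sum:
  "centered_square_sum J \<in> borel_measurable (std_normal_PiM J)"
  unfolding centered_square_sum_def
  by (intro borel_measurable_sum borel_measurable_diff borel_measurable_power
      measurable_std_normal_PiM_component) auto

text \<open>The summands are independent and centered with variance 2, so only the diagonal of the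
  squared sum contributes to the second moment.\<close>

lemma centered_square_sum_moments:
  fixes J :: "'i set" assumes fin: "finite J"
  shows "integrable (std_normal_PiM J) (centered_square_sum J)"
    and "integral\<^sup>L (std_normal_PiM J) (centered_square_sum J) = 0"
    and "integrable (std_normal_PiM J) (\<lambda>z. (centered_square_sum J z)\<^sup>2)"
    and "integral\<^sup>L (std_normal_PiM J) (\<lambda>z. (centered_square_sum J z)\<^sup>2) = 2 * card J"
proof -
  let ?N = "std_normal_distribution" and ?P = "std_normal_PiM J"
  interpret P: product_prob_space "\<lambda>_::'i. ?N"
    by (rule product_prob_spaceI) (rule std_normal.prob_space_axioms)
  have comp: "distr ?P ?N (\<lambda>z. z j) = ?N" if "j \<in> J" for j
    using that std_normal.prob_space_axioms by (intro distr_PiM_component)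
  have mc: "(\<lambda>z. z j) \<in> ?P \<rightarrow>\<^sub>M ?N" if "j \<in> J" for j
    using that by (rule measurable_component_singleton)
  have 1: "integrable ?P (\<lambda>z. (z j)\<^sup>2 - 1)" if "j \<in> J" for j
    using integrable_distr[OF mc[OF that], of "\<lambda>x. x\<^sup>2 - 1"] std_normal_centered_square(1)
    by (simp add: comp that)
  have 2: "integral\<^sup>L ?P (\<lambda>z. (z j)\<^sup>2 - 1) = 0" if "j \<in> J" for j
    using integral_distr[OF mc[OF that], of "\<lambda>x. x\<^sup>2 - 1"] std_normal_centered_square(2)
    by (simp add: comp that)
  have 3: "integrable ?P (\<lambda>z. ((z i)\<^sup>2 - 1) * ((z j)\<^sup>2 - 1))"
      and 4: "integral\<^sup>L ?P (\<lambda>z. ((z i)\<^sup>2 - 1) * ((z j)\<^sup>2 - 1)) = (if i = j then 2 else 0)"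
    if ij: "i \<in> J" "j \<in> J" for i j
  proof -
    \<comment> \<open>The two factors are spread over all coordinates, with 1 elsewhere, so that the
      product formula applies. For \<open>i = j\<close> both land on the same coordinate and give
      the square.\<close>
    define h :: "'i \<Rightarrow> real \<Rightarrow> real" where
      "h k x = (if k = i then x\<^sup>2 - 1 else 1) * (if k = j then x\<^sup>2 - 1 else 1)" for k x
    have h: "((z i)\<^sup>2 - 1) * ((z j)\<^sup>2 - 1) = (\<Prod>k\<in>J. h k (z k))" for z
      using ij fin unfolding h_def by (simp add: prod.distrib prod.delta)
    have ih: "integrable ?N (h k)" for k
      unfolding h_def using std_normal_centered_square by (cases "k = i"; cases "k = j") simp_all
    show "integrable ?P (\<lambda>z. ((z i)\<^sup>2 - 1) * ((z j)\<^sup>2 - 1))"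
      unfolding h by (rule P.product_integrable_prod[OF fin ih])
    have "integral\<^sup>L ?P (\<lambda>z. ((z i)\<^sup>2 - 1) * ((z j)\<^sup>2 - 1)) = (\<Prod>k\<in>J. integral\<^sup>L ?N (h k))"
      unfolding h by (rule P.product_integral_prod[OF fin ih])
    also have "\<dots> = (if i = j then 2 else 0)"
    proof (cases "i = j")
      case True
      then have "integral\<^sup>L ?N (h k) = (if k = i then 2 else 1)" for k
        unfolding h_def using std_normal_centered_square std_normal.prob_space by simp
      then show ?thesis using True ij fin by (simp add: prod.delta)
    next
      case False
      then have "integral\<^sup>L ?N (h i) = 0"
        unfolding h_def using std_normal_centered_square by simp
      then show ?thesis using False ij fin by auto
    qed
    finally show "integral\<^sup>L ?P (\<lambda>z. ((z i)\<^sup>2 - 1) * ((z j)\<^sup>2 - 1)) = (if i = j then 2 else 0)" .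
  qed
  show "integrable ?P (centered_square_sum J)"
    unfolding centered_square_sum_def using 1 by (rule Bochner_Integration.integrable_sum)
  show "integral\<^sup>L ?P (centered_square_sum J) = 0"
    unfolding centered_square_sum_def using 1 2 by (subst Bochner_Integration.integral_sum) auto
  have e: "(\<lambda>z. (centered_square_sum J z)\<^sup>2) = (\<lambda>z. \<Sum>i\<in>J. \<Sum>j\<in>J. ((z i)\<^sup>2 - 1) * ((z j)\<^sup>2 - 1))"
    unfolding centered_square_sum_def power2_eq_square sum_product by simp
  show "integrable ?P (\<lambda>z. (centered_square_sum J z)\<^sup>2)"
    unfolding e using 3 by (intro Bochner_Integration.integrable_sum)
  have "integral\<^sup>L ?P (\<lambda>z. (centered_square_sum J z)\<^sup>2) = (\<Sum>i\<in>J. \<Sum>j\<in>J. if i = j then 2 else 0)"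
    unfolding e using 3 4 by (simp add: Bochner_Integration.integral_sum Bochner_Integration.integrable_sum)
  then show "integral\<^sup>L ?P (\<lambda>z. (centered_square_sum J z)\<^sup>2) = 2 * card J"
    using fin by simp
qed

section \<open>Likelihood ratio of a scaled against the standard normal law\<close>

definition scale_density :: "real \<Rightarrow> real \<Rightarrow> real" where
  "scale_density v x = exp ((1 - 1 / v) * x\<^sup>2 / 2) / sqrt v"

lemma measurable_scale_density[measurable]: "scale_density v \<in> borel_measurable borel"
  unfolding scale_density_def[abs_def] by measurable

lemma scale_density_nonneg: "v > 0 \<Longrightarrow> 0 \<le> scale_density v x"
  by (simp add: scale_density_def)

text \<open>So \<open>scale_density v\<close> is the Radon-Nikodym derivative of N(0, v) with
  respect to N(0, 1): its exponent \<open>(1 - 1/v) x^2 / 2\<close> turns \<open>- x^2 / 2\<close>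
  into \<open>- x^2 / (2 v)\<close>.\<close>

lemma distr_std_normal_scale_eq_density:
  assumes v: "v > 0"
  shows "distr std_normal_distribution std_normal_distribution (\<lambda>x. sqrt v * x) =
         density std_normal_distribution (scale_density v)"
proof -
  let ?N = "std_normal_distribution"
  have "distributed ?N lborel (\<lambda>x. x) std_normal_density"
    by (simp add: distributed_def distr_id2)
  from std_normal.normal_density_affine[OF this, of "sqrt v" 0]
  have "distributed ?N lborel (\<lambda>x. sqrt v * x) (normal_density 0 (sqrt v))" using v by simp
  then have "distr ?N lborel (\<lambda>x. sqrt v * x) = density lborel (normal_density 0 (sqrt v))"
    by (rule distributed_distr_eq_density[symmetric, THEN sym])
  also have "\<dots> = density lborel (\<lambda>x. ennreal (std_normal_density x) * ennreal (scale_density v x))"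
  proof (rule arg_cong[where f="density lborel"], rule ext)
    fix x
    have "normal_density 0 (sqrt v) x = std_normal_density x * scale_density v x"
      using v unfolding normal_density_def scale_density_def
      by (simp add: real_sqrt_mult field_simps flip: exp_add)
    then show "ennreal (normal_density 0 (sqrt v) x) = ennreal (std_normal_density x) * ennreal (scale_density v x)"
      by (simp add: ennreal_mult' normal_density_nonneg)
  qed
  also have "\<dots> = density ?N (scale_density v)"
    by (subst density_density_eq) auto
  finally show ?thesis
    by (subst distr_cong[of ?N ?N ?N lborel _ "\<lambda>x. sqrt v * x"]) simp_all
qed

text \<open>By independence the ratio for the vector is the product of the coordinate ratios; on
  boxes the integral splits into one-dimensional ones.\<close>

lemma distr_std_normal_PiM_scale_eq_density:
  fixes J :: "'i set" assumes fin: "finite J" and v: "v > 0"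
  shows "distr (std_normal_PiM J) (std_normal_PiM J) (\<lambda>w. \<lambda>j\<in>J. sqrt v * w j) =
         density (std_normal_PiM J) (\<lambda>y. ennreal (\<Prod>j\<in>J. scale_density v (y j)))"
proof -
  let ?N = "std_normal_distribution" and ?P = "std_normal_PiM J" and ?l = "scale_density v"
  let ?L = "\<lambda>y. ennreal (\<Prod>j\<in>J. ?l (y j))"
  let ?D = "density ?N ?l"
  interpret P: product_prob_space "\<lambda>_::'i. ?N"
    by (rule product_prob_spaceI) (rule std_normal.prob_space_axioms)
  interpret D: prob_space ?D
    unfolding distr_std_normal_scale_eq_density[OF v, symmetric]
    by (rule std_normal.prob_space_distr) simp
  interpret PD: product_prob_space "\<lambda>_::'i. ?D"
    by (rule product_prob_spaceI) (rule D.prob_space_axioms)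
  have "(\<lambda>y. ?l (y j)) \<in> borel_measurable ?P" if "j \<in> J" for j
    using measurable_compose[OF measurable_std_normal_PiM_component[OF that] measurable_scale_density] .
  then have L: "?L \<in> borel_measurable ?P"
    by (intro measurable_compose[OF _ measurable_ennreal] borel_measurable_prod)
  have "density ?P ?L = Pi\<^sub>M J (\<lambda>_. ?D)"
  proof (rule PD.PiM_eqI[OF fin])
    show "sets (density ?P ?L) = sets (Pi\<^sub>M J (\<lambda>_. ?D))"
      by (simp, rule sets_PiM_cong) simp_all
  next
    fix A :: "'i \<Rightarrow> real set" assume "\<And>j. j \<in> J \<Longrightarrow> A j \<in> sets ?D"
    then have A: "\<And>j. j \<in> J \<Longrightarrow> A j \<in> sets borel" by simp
    then have PA: "Pi\<^sub>E J A \<in> sets ?P" using fin by (intro sets_PiM_I_finite) auto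
    have "emeasure (density ?P ?L) (Pi\<^sub>E J A) = (\<integral>\<^sup>+y. ?L y * indicator (Pi\<^sub>E J A) y \<partial>?P)"
      by (rule emeasure_density[OF L PA])
    also have "\<dots> = (\<integral>\<^sup>+y. (\<Prod>j\<in>J. ennreal (?l (y j)) * indicator (A j) (y j)) \<partial>?P)"
    proof (rule nn_integral_cong)
      fix y assume "y \<in> space ?P"
      then have "indicator (Pi\<^sub>E J A) y = (\<Prod>j\<in>J. indicator (A j) (y j) :: ennreal)"
        using fin by (auto simp: indicator_def space_PiM PiE_iff prod_zero_iff)
      then show "?L y * indicator (Pi\<^sub>E J A) y = (\<Prod>j\<in>J. ennreal (?l (y j)) * indicator (A j) (y j))"
        using v by (simp add: prod.distrib prod_ennreal scale_density_nonneg)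
    qed
    also have "\<dots> = (\<Prod>j\<in>J. \<integral>\<^sup>+x. ennreal (?l x) * indicator (A j) x \<partial>?N)"
    proof (rule P.product_nn_integral_prod[OF fin])
      fix j assume "j \<in> J"
      then have [measurable]: "A j \<in> sets borel" by (rule A)
      show "(\<lambda>x. ennreal (?l x) * indicator (A j) x) \<in> borel_measurable ?N" by simp
    qed
    also have "\<dots> = (\<Prod>j\<in>J. emeasure ?D (A j))"
      by (intro prod.cong refl emeasure_density[symmetric]) (use A in auto)
    finally show "emeasure (density ?P ?L) (Pi\<^sub>E J A) = (\<Prod>j\<in>J. emeasure ?D (A j))" .
  qed
  then show ?thesis
    by (simp add: distr_std_normal_PiM_scale[OF fin] distr_std_normal_scale_eq_density[OF v])
qed

text \<open>Against the standard normal density the squared ratio is a multiple of another Gaussian,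
  with exponent \<open>- x^2 (2 - v) / (2 v)\<close>. Its variance is \<open>v / (2 - v)\<close>,
  which is where \<open>v < 2\<close> enters.\<close>

lemma scale_density_square:
  assumes v: "0 < v" "v < 2"
  shows "integrable std_normal_distribution (\<lambda>x. (scale_density v x)\<^sup>2)"
    and "integral\<^sup>L std_normal_distribution (\<lambda>x. (scale_density v x)\<^sup>2) = 1 / sqrt (1 - (v - 1)\<^sup>2)"
proof -
  define \<sigma> where "\<sigma> = sqrt (v / (2 - v))"
  have \<sigma>: "\<sigma> > 0" using v by (simp add: \<sigma>_def)
  have sq: "1 - (v - 1)\<^sup>2 = v * (2 - v)" by (simp add: power2_eq_square algebra_simps)
  have e: "std_normal_density x * (scale_density v x)\<^sup>2 = 1 / sqrt (v * (2 - v)) * normal_density 0 \<sigma> x" for x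
  proof -
    have "std_normal_density x * (scale_density v x)\<^sup>2 =
        exp (- x\<^sup>2 / 2 + ((1 - 1 / v) * x\<^sup>2 / 2 + (1 - 1 / v) * x\<^sup>2 / 2)) / (v * sqrt (2 * pi))"
      using v unfolding std_normal_density_def scale_density_def exp_add power_divide
        power2_eq_square[of "exp _"] by simp
    also have "- x\<^sup>2 / 2 + ((1 - 1 / v) * x\<^sup>2 / 2 + (1 - 1 / v) * x\<^sup>2 / 2) = - x\<^sup>2 / (2 * (v / (2 - v)))"
      using v by (simp add: field_simps)
    also have "v * sqrt (2 * pi) = sqrt (v * (2 - v)) * sqrt (2 * pi * (v / (2 - v)))"
      using v by (simp add: real_sqrt_mult real_sqrt_divide)
    finally show ?thesis
      using v unfolding normal_density_def \<sigma>_def by simp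
  qed
  show "integrable std_normal_distribution (\<lambda>x. (scale_density v x)\<^sup>2)"
    using \<sigma> by (subst integrable_density) (auto simp: normal_density_nonneg e simp del: times_divide_eq_left)
  show "integral\<^sup>L std_normal_distribution (\<lambda>x. (scale_density v x)\<^sup>2) = 1 / sqrt (1 - (v - 1)\<^sup>2)"
    using \<sigma> by (subst integral_density) (auto simp: normal_density_nonneg e sq simp del: times_divide_eq_left)
qed

text \<open>With \<open>y = u / (1 - u)\<close> one has
  \<open>1 / (1 - u) = 1 + y \<le> exp y\<close>, so the power is at most
  \<open>exp (n y / 2)\<close>, which is then expanded to second order. For
  \<open>u = (v - 1)^2\<close> and \<open>n\<close> the dimension, the part
  \<open>1 + u n / 2\<close> is exactly what is subtracted in the second moment of the remainder
  below, leaving order \<open>(u n)^2\<close>.\<close>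

lemma inverse_sqrt_power_le:
  fixes u :: real
  assumes u: "0 \<le> u" and n: "n \<ge> 1" and un: "u * real n \<le> 1 / 2"
  shows "(1 / sqrt (1 - u)) ^ n \<le> 1 + u * n / 2 + 2 * (u * n)\<^sup>2"
proof -
  define y where "y = u / (1 - u)"
  have "u \<le> u * real n" using u n by (simp add: mult_le_cancel_left1)
  then have u2: "u \<le> 1 / 2" using un by linarith
  have "y = u + u * y" using u2 by (simp add: y_def field_simps)
  moreover have y: "0 \<le> y" "y \<le> 2 * u" 
    using u u2 mult_left_mono[of "1 / (1 - u)" 2 u] by (simp_all add: y_def field_simps)
  ultimately have yu: "y \<le> u + 2 * u\<^sup>2"
    using mult_left_mono[OF y(2) u] by (simp add: power2_eq_square)
  have "1 / (1 - u) = 1 + y" using u2 by (simp add: y_def field_simps)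
  then have "1 / sqrt (1 - u) = sqrt (1 + y)" using real_sqrt_divide[of 1 "1 - u"] by simp
  also have "\<dots> \<le> sqrt (exp y)" by simp
  also have "\<dots> = exp (y / 2)" by (rule real_sqrt_unique) (simp_all add: power2_eq_square flip: exp_add)
  finally have "(1 / sqrt (1 - u)) ^ n \<le> exp (y / 2) ^ n"
    using u2 by (intro power_mono) auto
  also have "\<dots> = exp (n * y / 2)" by (simp flip: exp_of_nat_mult)
  also have "\<dots> \<le> 1 + n * y / 2 + (n * y / 2)\<^sup>2"
  proof (rule exp_bound)
    show "0 \<le> n * y / 2" using y by simp
    have "n * y \<le> n * (2 * u)" using y by (intro mult_left_mono) auto
    then show "n * y / 2 \<le> 1" using un by (simp add: mult_ac)
  qed
  \<comment> \<open>One \<open>(u n)^2\<close> pays for replacing \<open>y\<close> by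
    \<open>u\<close> in the linear term, the other for the quadratic term.\<close>
  also have "\<dots> \<le> 1 + u * n / 2 + 2 * (u * n)\<^sup>2"
  proof -
    have "n * y \<le> n * (u + 2 * u\<^sup>2)" using yu by (intro mult_left_mono) auto
    moreover have "n * u\<^sup>2 \<le> n * (n * u\<^sup>2)" using n by (intro mult_left_mono) (auto simp: mult_le_cancel_right1)
    ultimately have 1: "n * y / 2 \<le> u * n / 2 + (u * n)\<^sup>2"
      by (simp add: power2_eq_square algebra_simps)
    have "n * y / 2 \<le> u * n" using mult_left_mono[OF y(2), of "real n"] by (simp add: mult_ac)
    then have "(n * y / 2)\<^sup>2 \<le> (u * n)\<^sup>2" using y by (intro power_mono) auto
    with 1 show ?thesis by linarith
  qed
  finally show ?thesis .
qed

section \<open>Expansion of the distribution function of the squared norm in the scale\<close>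

definition scaled_sq_norm_cdf :: "'i set \<Rightarrow> real \<Rightarrow> real \<Rightarrow> real" where
  "scaled_sq_norm_cdf J x v =
     measure (std_normal_PiM J) {w \<in> space (std_normal_PiM J). v * (\<Sum>j\<in>J. (w j)\<^sup>2) \<le> x}"

lemma measurable_sq_norm:
  "(\<lambda>w. \<Sum>j\<in>J. (w j)\<^sup>2) \<in> borel_measurable (std_normal_PiM J)"
  by (intro borel_measurable_sum borel_measurable_power measurable_std_normal_PiM_component) auto

lemma scaled_sq_norm_cdf_bounds: "0 \<le> scaled_sq_norm_cdf J x v" "scaled_sq_norm_cdf J x v \<le> 1"
  unfolding scaled_sq_norm_cdf_def using prob_space.prob_le_1[OF prob_space_std_normal_PiM] by auto

text \<open>A Cauchy-Schwarz bound with a free weight, from integrating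
  \<open>2 |f| \<le> f^2 / a + a\<close>. If the second moment is of order \<open>a^2\<close>, the
  first absolute moment is of order \<open>a\<close>.\<close>

lemma integral_abs_half_le:
  fixes f :: "'a \<Rightarrow> real"
  assumes f: "integrable M f" "integrable M (\<lambda>x. (f x)\<^sup>2)" and M: "prob_space M" and a: "a > 0"
  shows "integral\<^sup>L M (\<lambda>x. \<bar>f x\<bar>) \<le> (integral\<^sup>L M (\<lambda>x. (f x)\<^sup>2) / a + a) / 2"
proof -
  interpret prob_space M by fact
  have "\<bar>f x\<bar> \<le> ((f x)\<^sup>2 / a + a) / 2" for x
  proof -
    have "0 \<le> (\<bar>f x\<bar> - a)\<^sup>2 / a" using a by simp
    also have "\<dots> = (f x)\<^sup>2 / a - 2 * \<bar>f x\<bar> + a" using a by (simp add: power2_eq_square field_simps)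
    finally show ?thesis by simp
  qed
  then have "integral\<^sup>L M (\<lambda>x. \<bar>f x\<bar>) \<le> integral\<^sup>L M (\<lambda>x. ((f x)\<^sup>2 / a + a) / 2)"
    using f by (intro integral_mono) auto
  also have "\<dots> = (integral\<^sup>L M (\<lambda>x. (f x)\<^sup>2) / a + a) / 2"
    using f by (simp add: prob_space)
  finally show ?thesis .
qed

text \<open>\<open>R\<close> is the remainder of the first-order expansion of \<open>L\<close> in
  \<open>v - 1\<close>. Write q for the centered square sum and d for \<open>card J\<close>.
  Expanding the square, the second moment follows exactly from E L = 1, E q = 0, E q^2 = 2 d, E (L
  q) = (v - 1) d and E L^2 = (1 - (v - 1)^2)^(-d/2).\<close>

lemma likelihood_ratio_second_order:
  fixes J :: "'i set" assumes fin: "finite J" and v: "0 < v" "v < 2"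
  defines "L \<equiv> \<lambda>y. \<Prod>j\<in>J. scale_density v (y j)"
  defines "R \<equiv> \<lambda>y. L y - 1 - (v - 1) * (centered_square_sum J y / 2)"
  shows "integrable (std_normal_PiM J) L" "integrable (std_normal_PiM J) R"
    and "integrable (std_normal_PiM J) (\<lambda>y. (R y)\<^sup>2)"
    and "integral\<^sup>L (std_normal_PiM J) (\<lambda>y. (R y)\<^sup>2) =
         (1 / sqrt (1 - (v - 1)\<^sup>2)) ^ card J - 1 - (v - 1)\<^sup>2 * card J / 2"
proof -
  let ?N = "std_normal_distribution" and ?P = "std_normal_PiM J" and ?q = "centered_square_sum J"
  define D where "D = density ?P (\<lambda>y. ennreal (L y))"
  define sc where "sc = (\<lambda>w::'i\<Rightarrow>real. \<lambda>j\<in>J. sqrt v * w j)"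
  interpret P: product_prob_space "\<lambda>_::'i. ?N"
    by (rule product_prob_spaceI) (rule std_normal.prob_space_axioms)
  interpret PJ: prob_space ?P by (rule prob_space_std_normal_PiM)
  note q = centered_square_sum_moments[OF fin]
  have qm[measurable]: "?q \<in> borel_measurable ?P" by (rule measurable_centered_square_sum)
  have D: "distr ?P ?P sc = D"
    unfolding D_def L_def sc_def by (rule distr_std_normal_PiM_scale_eq_density[OF fin v(1)])
  have scm[measurable]: "sc \<in> ?P \<rightarrow>\<^sub>M ?P"
    unfolding sc_def by (intro measurable_into_std_normal_PiM borel_measurable_times
        measurable_std_normal_PiM_component) auto
  have "(\<lambda>y. scale_density v (y j)) \<in> borel_measurable ?P" if "j \<in> J" for j
    using measurable_compose[OF measurable_std_normal_PiM_component[OF that] measurable_scale_density] .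
  then have Lm[measurable]: "L \<in> borel_measurable ?P"
    unfolding L_def by (rule borel_measurable_prod)
  have L0: "L y \<ge> 0" for y unfolding L_def using v by (intro prod_nonneg) (simp add: scale_density_nonneg)
  have qsc: "?q (sc w) = v * ?q w + (v - 1) * card J" for w
    using v by (simp add: centered_square_sum_def sc_def power_mult_distrib sum_subtractf sum_distrib_left algebra_simps)
  \<comment> \<open>Since \<open>L\<close> is the density of the law of the scaled vector, moments
    weighted by \<open>L\<close> are plain moments of that vector.\<close>
  have "integrable ?P (\<lambda>w. ?q (sc w))" unfolding qsc using q by simp
  then have "integrable D ?q" unfolding D[symmetric] by (subst integrable_distr_eq) auto
  then have Lq: "integrable ?P (\<lambda>y. L y * ?q y)"
    unfolding D_def by (subst (asm) integrable_density) (auto simp: L0)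
  have "integral\<^sup>L ?P (\<lambda>y. L y * ?q y) = integral\<^sup>L D ?q"
    unfolding D_def by (subst integral_density) (auto simp: L0)
  also have "\<dots> = integral\<^sup>L ?P (\<lambda>w. ?q (sc w))"
    unfolding D[symmetric] by (rule integral_distr) measurable
  also have "\<dots> = (v - 1) * card J" unfolding qsc using q by (simp add: PJ.prob_space)
  finally have ILq: "integral\<^sup>L ?P (\<lambda>y. L y * ?q y) = (v - 1) * card J" .
  have "integrable D (\<lambda>_. 1::real)"
    unfolding D[symmetric] by (subst integrable_distr_eq) auto
  then show L: "integrable ?P L"
    unfolding D_def by (subst (asm) integrable_density) (auto simp: L0)
  have "integral\<^sup>L ?P L = integral\<^sup>L D (\<lambda>_. 1::real)"
    unfolding D_def by (subst integral_density) (auto simp: L0)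
  also have "\<dots> = 1"
    unfolding D[symmetric] by (subst integral_distr) (auto simp: PJ.prob_space)
  finally have IL: "integral\<^sup>L ?P L = 1" .
  have L2e: "(L y)\<^sup>2 = (\<Prod>j\<in>J. (scale_density v (y j))\<^sup>2)" for y
    unfolding L_def by (simp add: prod_power_distrib)
  have L2: "integrable ?P (\<lambda>y. (L y)\<^sup>2)"
    unfolding L2e by (rule P.product_integrable_prod[OF fin scale_density_square(1)[OF v]])
  have IL2: "integral\<^sup>L ?P (\<lambda>y. (L y)\<^sup>2) = (1 / sqrt (1 - (v - 1)\<^sup>2)) ^ card J"
    unfolding L2e
    by (subst P.product_integral_prod[OF fin scale_density_square(1)[OF v]])
       (simp add: scale_density_square(2)[OF v])
  show "integrable ?P R" unfolding R_def using L q by simp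
  have R2: "(R y)\<^sup>2 = (L y)\<^sup>2 + 1 + (v - 1)\<^sup>2 / 4 * (?q y)\<^sup>2 - 2 * L y - (v - 1) * (L y * ?q y) + (v - 1) * ?q y" for y
    unfolding R_def by (simp add: power2_eq_square field_simps)
  show "integrable ?P (\<lambda>y. (R y)\<^sup>2)" unfolding R2 using L L2 Lq q by simp
  show "integral\<^sup>L ?P (\<lambda>y. (R y)\<^sup>2) =
      (1 / sqrt (1 - (v - 1)\<^sup>2)) ^ card J - 1 - (v - 1)\<^sup>2 * card J / 2"
    unfolding R2 using L L2 Lq q
    by (simp add: IL IL2 ILq PJ.prob_space) (simp add: power2_eq_square)
qed

text \<open>Let \<open>c\<close> be the integral of half the centered square sum over the event
  \<open>A\<close>. Near \<open>v = 1\<close> the error is then the integral over \<open>A\<close>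
  of the remainder \<open>R\<close>, hence at most the first absolute moment of \<open>R\<close>.
  The slope \<open>c\<close> may depend on \<open>x\<close>, but the constant 4 does not.\<close>

lemma scaled_sq_norm_cdf_taylor:
  fixes J :: "'i set" assumes fin: "finite J" and ne: "J \<noteq> {}"
  obtains c :: real where "\<And>v::real. v \<ge> 0 \<Longrightarrow>
    \<bar>scaled_sq_norm_cdf J x v - scaled_sq_norm_cdf J x 1 - (v - 1) * c\<bar> \<le> 4 * card J * (v - 1)\<^sup>2"
proof -
  let ?P = "std_normal_PiM J" and ?q = "centered_square_sum J" and ?g = "scaled_sq_norm_cdf J x"
  define A where "A = {w \<in> space ?P. (\<Sum>j\<in>J. (w j)\<^sup>2) \<le> x}"
  define c where "c = integral\<^sup>L ?P (\<lambda>y. indicator A y * (?q y / 2))"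
  interpret PJ: prob_space ?P by (rule prob_space_std_normal_PiM)
  note q = centered_square_sum_moments[OF fin]
  have d: "card J \<ge> 1" using fin ne by (simp add: Suc_leI card_gt_0_iff)
  have A[measurable]: "A \<in> sets ?P"
    unfolding A_def using measurable_sq_norm by measurable
  have mult_ind: "integrable ?P (\<lambda>y. indicator A y * f y)" if "integrable ?P f" for f :: "_ \<Rightarrow> real"
    using integrable_mult_indicator[OF A that] by simp
  have ind_le: "\<bar>integral\<^sup>L ?P (\<lambda>y. indicator A y * f y)\<bar> \<le> integral\<^sup>L ?P (\<lambda>y. \<bar>f y\<bar>)"
    if "integrable ?P f" for f :: "_ \<Rightarrow> real"
  proof -
    have "\<bar>integral\<^sup>L ?P (\<lambda>y. indicator A y * f y)\<bar> \<le> integral\<^sup>L ?P (\<lambda>y. \<bar>indicator A y * f y\<bar>)"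
      by (rule integral_abs_bound)
    also have "\<dots> \<le> integral\<^sup>L ?P (\<lambda>y. \<bar>f y\<bar>)"
      using that mult_ind[OF that]
      by (intro integral_mono integrable_abs) (auto simp: indicator_def)
    finally show ?thesis .
  qed
  have main: "\<bar>?g v - ?g 1 - (v - 1) * c\<bar> \<le> 4 * card J * (v - 1)\<^sup>2" if v0: "v \<ge> 0" for v :: real
  proof -
    define \<delta> where "\<delta> = v - 1"
    \<comment> \<open>Half of \<open>a\<close> is the second moment of the linear term, and
      \<open>a \<le> 1 / 2\<close> is the range of \<open>inverse_sqrt_power_le\<close>.\<close>
    define a :: real where "a = \<delta>\<^sup>2 * card J"
    show ?thesis
    proof (cases "a \<le> 1 / 2")
      \<comment> \<open>Far from 1 crude bounds suffice: the two probabilities differ by at most 1,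
        the linear term is bounded through its second moment with weight 1, and
        \<open>3/2 + a/4\<close> is below \<open>4 a\<close> when \<open>a\<close> exceeds
        1/2.\<close>
      case False
      have "integrable ?P (\<lambda>y. \<delta> * (?q y / 2))" using q by simp
      moreover have "integrable ?P (\<lambda>y. (\<delta> * (?q y / 2))\<^sup>2)"
        using q by (simp add: power_mult_distrib power_divide)
      ultimately have "integral\<^sup>L ?P (\<lambda>y. \<bar>\<delta> * (?q y / 2)\<bar>) \<le>
          (integral\<^sup>L ?P (\<lambda>y. (\<delta> * (?q y / 2))\<^sup>2) / 1 + 1) / 2"
        by (intro integral_abs_half_le PJ.prob_space_axioms) auto
      also have "integral\<^sup>L ?P (\<lambda>y. (\<delta> * (?q y / 2))\<^sup>2) = a / 2"
        using q by (simp add: power_mult_distrib power_divide a_def)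
      finally have "integral\<^sup>L ?P (\<lambda>y. \<bar>\<delta> * (?q y / 2)\<bar>) \<le> (a / 2 + 1) / 2" by simp
      moreover have "\<delta> * c = integral\<^sup>L ?P (\<lambda>y. indicator A y * (\<delta> * (?q y / 2)))"
        unfolding c_def by (subst integral_mult_right_zero[symmetric]) (simp add: mult_ac)
      ultimately have "\<bar>\<delta> * c\<bar> \<le> (a / 2 + 1) / 2"
        using ind_le[of "\<lambda>y. \<delta> * (?q y / 2)"] q by simp
      then have "\<bar>?g v - ?g 1 - \<delta> * c\<bar> \<le> 1 + (a / 2 + 1) / 2"
        using scaled_sq_norm_cdf_bounds[of J x v] scaled_sq_norm_cdf_bounds[of J x 1] by linarith
      also have "\<dots> \<le> 4 * a" using False by argo
      finally show ?thesis by (simp add: a_def \<delta>_def mult_ac)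
    next
      case True
      have "\<delta>\<^sup>2 \<le> a" unfolding a_def using d by (simp add: mult_le_cancel_left1)
      then have "\<delta>\<^sup>2 < 1" using True by linarith
      then have "\<bar>\<delta>\<bar> < 1" by (simp add: abs_square_less_1)
      then have v: "0 < v" "v < 2" by (auto simp: \<delta>_def)
      define L where "L = (\<lambda>y. \<Prod>j\<in>J. scale_density v (y j))"
      define R where "R = (\<lambda>y. L y - 1 - \<delta> * (?q y / 2))"
      have LR: "integrable ?P L" "integrable ?P R" "integrable ?P (\<lambda>y. (R y)\<^sup>2)"
        "integral\<^sup>L ?P (\<lambda>y. (R y)\<^sup>2) = (1 / sqrt (1 - \<delta>\<^sup>2)) ^ card J - 1 - \<delta>\<^sup>2 * card J / 2"
        unfolding L_def R_def \<delta>_def by (rule likelihood_ratio_second_order[OF fin v])+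
      have L0: "L y \<ge> 0" for y unfolding L_def using v by (intro prod_nonneg) (simp add: scale_density_nonneg)
      \<comment> \<open>The factor \<open>v\<close> moves from the event into the measure: the event
        is the preimage of \<open>A\<close> under scaling by \<open>sqrt v\<close>, and the scaled
        law has density \<open>L\<close>.\<close>
      have gv: "?g v = integral\<^sup>L ?P (\<lambda>y. indicator A y * L y)"
      proof -
        define sc where "sc = (\<lambda>w::'i\<Rightarrow>real. \<lambda>j\<in>J. sqrt v * w j)"
        have scm: "sc \<in> ?P \<rightarrow>\<^sub>M ?P"
          unfolding sc_def by (intro measurable_into_std_normal_PiM borel_measurable_times
              measurable_std_normal_PiM_component) auto
        have "{w \<in> space ?P. v * (\<Sum>j\<in>J. (w j)\<^sup>2) \<le> x} = sc -` A \<inter> space ?P"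
          using v measurable_space[OF scm] unfolding A_def
          by (auto simp: sc_def power_mult_distrib sum_distrib_left)
        then have "?g v = measure (distr ?P ?P sc) A"
          unfolding scaled_sq_norm_cdf_def by (simp add: measure_distr[OF scm A])
        also have "distr ?P ?P sc = density ?P (\<lambda>y. ennreal (L y))"
          unfolding L_def sc_def by (rule distr_std_normal_PiM_scale_eq_density[OF fin v(1)])
        also have "measure \<dots> A = integral\<^sup>L (density ?P (\<lambda>y. ennreal (L y))) (indicator A)"
          using sets.sets_into_space[OF A] by (simp add: Int_absorb2)
        also have "\<dots> = integral\<^sup>L ?P (\<lambda>y. L y * indicator A y)"
          using LR(1) A by (subst integral_density) (auto simp: L0)
        finally show ?thesis by (simp add: mult.commute)
      qed
      have g1: "?g 1 = integral\<^sup>L ?P (\<lambda>y. indicator A y * 1)"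
        using sets.sets_into_space[OF A] unfolding scaled_sq_norm_cdf_def A_def[symmetric]
        by (simp add: Int_absorb2 A_def[symmetric])
      have "\<delta> * c = integral\<^sup>L ?P (\<lambda>y. indicator A y * (\<delta> * (?q y / 2)))"
        unfolding c_def by (subst integral_mult_right_zero[symmetric]) (simp add: mult_ac)
      then have "?g v - ?g 1 - \<delta> * c = integral\<^sup>L ?P (\<lambda>y. indicator A y * R y)"
        unfolding gv g1 R_def
        using mult_ind[OF LR(1)] mult_ind[of "\<lambda>_. 1"] mult_ind[of "\<lambda>y. \<delta> * (?q y / 2)"] q
        by (simp add: right_diff_distrib)
      then have le: "\<bar>?g v - ?g 1 - \<delta> * c\<bar> \<le> integral\<^sup>L ?P (\<lambda>y. \<bar>R y\<bar>)"
        using ind_le[OF LR(2)] by simp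
      \<comment> \<open>The weight used in \<open>integral_abs_half_le\<close> is \<open>a\<close>,
        which has to be positive.\<close>
      show ?thesis
      proof (cases "\<delta> = 0")
        case True then show ?thesis by (simp add: \<delta>_def)
      next
        case False
        then have a: "a > 0" using d by (simp add: a_def)
        have "integral\<^sup>L ?P (\<lambda>y. (R y)\<^sup>2) \<le> 2 * a\<^sup>2"
          using inverse_sqrt_power_le[of "\<delta>\<^sup>2" "card J"] d True unfolding LR(4) a_def by simp
        then have "integral\<^sup>L ?P (\<lambda>y. (R y)\<^sup>2) / a \<le> 2 * a"
          using a by (simp add: field_simps power2_eq_square)
        then have "integral\<^sup>L ?P (\<lambda>y. \<bar>R y\<bar>) \<le> (2 * a + a) / 2"
          by (intro order_trans[OF integral_abs_half_le[OF LR(2,3) PJ.prob_space_axioms a]]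
              divide_right_mono add_right_mono) simp_all
        also have "(2 * a + a) / 2 \<le> 4 * a" using a by simp
        finally have "\<bar>?g v - ?g 1 - \<delta> * c\<bar> \<le> 4 * a" using le by (rule order_trans[rotated])
        then show ?thesis by (simp add: a_def \<delta>_def mult_ac)
      qed
    qed
  qed
  show thesis by (rule that[of c]) (rule main)
qed

subsection \<open>The law of the normalized sum\<close>

lemma subalgebra_sigma_gen:
  assumes "\<And>i. i \<in> I \<Longrightarrow> Z i \<in> M \<rightarrow>\<^sub>M N"
  shows "subalgebra M (sigma_gen M N Z I)"
proof -
  have "(\<lambda>\<omega>. \<lambda>i\<in>I. Z i \<omega>) \<in> M \<rightarrow>\<^sub>M Pi\<^sub>M I (\<lambda>_. N)"
    using assms by (rule measurable_restrict)
  then show ?thesis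
    by (simp add: subalgebra_def sigma_gen_def measurable_iff_sets)
qed

lemma measurable_scale_vec:
  "(\<lambda>(e, z). \<lambda>j\<in>{..<d}. e * z j) \<in> std_normal_distribution \<Otimes>\<^sub>M std_normal_PiM {..<d} \<rightarrow>\<^sub>M borel_vec d"
proof -
  have "(\<lambda>p. fst p * snd p j) \<in> borel_measurable (std_normal_distribution \<Otimes>\<^sub>M std_normal_PiM {..<d})"
    if "j < d" for j
  proof (rule borel_measurable_times)
    have "fst \<in> std_normal_distribution \<Otimes>\<^sub>M std_normal_PiM {..<d} \<rightarrow>\<^sub>M std_normal_distribution"
      by (rule measurable_fst)
    then show "fst \<in> borel_measurable (std_normal_distribution \<Otimes>\<^sub>M std_normal_PiM {..<d})"
      by simp
    show "(\<lambda>p. snd p j) \<in> borel_measurable (std_normal_distribution \<Otimes>\<^sub>M std_normal_PiM {..<d})"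
      using that by (intro measurable_compose[OF measurable_snd measurable_std_normal_PiM_component]) simp
  qed
  then show ?thesis
    unfolding borel_vec_def case_prod_beta by (intro measurable_restrict) simp
qed

text \<open>Given the vectors, the conditional law is that of a scalar standard normal times
  \<open>Z i\<close>, by \<open>centered_normal_rank_one\<close>. Averaging it over
  \<open>Z i\<close> gives the law of \<open>X i\<close>, and Tonelli rewrites the average as an
  integral over independent scalar and vector.\<close>

lemma mixed_normal_sample_law:
  assumes M: "prob_space M" and sample: "mixed_normal_sample M d n Z X" and i: "i \<in> {1..n}"
  shows "distr M (borel_vec d) (X i) =
    distr (std_normal_distribution \<Otimes>\<^sub>M std_normal_PiM {..<d}) (borel_vec d)
      (\<lambda>(e, z). \<lambda>j\<in>{..<d}. e * z j)"
proof -
  let ?N = "std_normal_distribution" and ?P = "std_normal_PiM {..<d}" and ?B = "borel_vec d"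
  let ?F = "\<lambda>(e, z). \<lambda>j\<in>{..<d}. e * z j"
  let ?G = "sigma_gen M ?B Z {1..n}"
  interpret M: prob_space M by fact
  interpret P: prob_space ?P by (rule prob_space_std_normal_PiM)
  interpret NP: pair_prob_space ?N ?P ..
  from sample i have law: "\<And>k. k \<in> {1..n} \<Longrightarrow> has_law M ?B (Z k) (std_normal_vec d)"
    unfolding mixed_normal_sample_def by blast
  from sample i obtain \<kappa> where \<kappa>: "\<And>\<omega>. \<omega> \<in> space M \<Longrightarrow> centered_normal d (\<lambda>a b. Z i \<omega> a * Z i \<omega> b) (\<kappa> \<omega>)"
    and cond: "has_cond_law M ?G ?B (X i) \<kappa>"
    unfolding mixed_normal_sample_def by blast
  have X[measurable]: "X i \<in> M \<rightarrow>\<^sub>M ?B" using cond by (simp add: has_cond_law_def)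
  have Z: "k \<in> {1..n} \<Longrightarrow> Z k \<in> M \<rightarrow>\<^sub>M ?B" for k using law by (simp add: has_law_def)
  have Zi: "Z i \<in> M \<rightarrow>\<^sub>M ?P"
    using Z[OF i] sets_std_normal_PiM[of d] by (simp cong: measurable_cong_sets)
  have "distr M ?B (Z i) = ?P" using law[OF i] by (simp add: has_law_def std_normal_vec_eq)
  then have Zlaw: "distr M ?P (Z i) = ?P"
    using sets_std_normal_PiM[of d] by (metis distr_cong)
  interpret G: finite_measure_subalgebra M ?G
    using Z by unfold_locales (intro subalgebra_sigma_gen)
  note F = measurable_scale_vec[of d]
  show ?thesis
  proof (rule measure_eqI)
    fix B assume "B \<in> sets (distr M ?B (X i))"
    then have B: "B \<in> sets ?B" by simp
    define E where "E = ?F -` B \<inter> space (?N \<Otimes>\<^sub>M ?P)"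
    have E: "E \<in> sets (?N \<Otimes>\<^sub>M ?P)" unfolding E_def by (rule measurable_sets[OF F B])
    \<comment> \<open>The probability that a standard normal multiple of \<open>z\<close> falls in
      \<open>B\<close>, written as the measure of a section so that Tonelli applies.\<close>
    define h where "h z = emeasure ?N ((\<lambda>e. (e, z)) -` E)" for z
    have h[measurable]: "h \<in> borel_measurable ?P"
      unfolding h_def by (rule NP.measurable_emeasure_Pair2[OF E])
    have \<kappa>h: "measure (\<kappa> \<omega>) B = enn2real (h (Z i \<omega>))" if \<omega>: "\<omega> \<in> space M" for \<omega>
    proof -
      let ?s = "\<lambda>e. \<lambda>j\<in>{..<d}. e * Z i \<omega> j"
      have "\<kappa> \<omega> = distr ?N ?B ?s" by (rule centered_normal_rank_one[OF \<kappa>[OF \<omega>]])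
      moreover have "?s \<in> ?N \<rightarrow>\<^sub>M ?B"
        unfolding borel_vec_def by (rule measurable_restrict) simp
      moreover have "?s -` B \<inter> space ?N = (\<lambda>e. (e, Z i \<omega>)) -` E"
        using measurable_space[OF Zi \<omega>] by (auto simp: E_def space_pair_measure)
      ultimately have "measure (\<kappa> \<omega>) B = measure ?N ((\<lambda>e. (e, Z i \<omega>)) -` E)"
        using B by (metis measure_distr)
      then show ?thesis by (simp add: h_def measure_def)
    qed
    have XB: "X i -` B \<inter> space M \<in> sets M" using B by measurable
    have "measure M (X i -` B \<inter> space M) = (\<integral>\<omega>. indicator (X i -` B \<inter> space M) \<omega> \<partial>M)"
      using XB by simp
    \<comment> \<open>Conditional expectation preserves the integral, so only the averaged kernel
      remains.\<close>
    also have "\<dots> = (\<integral>\<omega>. real_cond_exp M ?G (indicator (X i -` B \<inter> space M)) \<omega> \<partial>M)"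
      using XB by (intro G.real_cond_exp_int(2)[symmetric]) (simp add: M.emeasure_finite less_top[symmetric])
    also have "\<dots> = (\<integral>\<omega>. enn2real (h (Z i \<omega>)) \<partial>M)"
    proof (rule integral_cong_AE)
      show "AE \<omega> in M. real_cond_exp M ?G (indicator (X i -` B \<inter> space M)) \<omega> = enn2real (h (Z i \<omega>))"
        using cond B \<kappa>h unfolding has_cond_law_def by fastforce
      show "(\<lambda>\<omega>. enn2real (h (Z i \<omega>))) \<in> borel_measurable M"
        using measurable_compose[OF Zi h] by measurable
    qed (rule borel_measurable_cond_exp2)
    finally have meas: "measure M (X i -` B \<inter> space M) = (\<integral>\<omega>. enn2real (h (Z i \<omega>)) \<partial>M)" .
    have h1: "h z \<le> 1" for z unfolding h_def by (rule std_normal.emeasure_le_1)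
    have hZ: "(\<lambda>\<omega>. h (Z i \<omega>)) \<in> borel_measurable M" by (rule measurable_compose[OF Zi h])
    have "emeasure (distr M ?B (X i)) B = ennreal (\<integral>\<omega>. enn2real (h (Z i \<omega>)) \<partial>M)"
      by (simp add: emeasure_distr[OF X B] M.emeasure_eq_measure meas)
    also have "\<dots> = (\<integral>\<^sup>+\<omega>. ennreal (enn2real (h (Z i \<omega>))) \<partial>M)"
    proof (rule nn_integral_eq_integral[symmetric])
      have "enn2real (h z) \<le> 1" for z using enn2real_mono[OF h1, of z] by simp
      then show "integrable M (\<lambda>\<omega>. enn2real (h (Z i \<omega>)))"
        using hZ by (intro M.integrable_const_bound[where B=1]) auto
    qed simp
    also have "\<dots> = (\<integral>\<^sup>+\<omega>. h (Z i \<omega>) \<partial>M)"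
      using le_less_trans[OF h1] by (intro nn_integral_cong ennreal_enn2real) simp
    also have "\<dots> = (\<integral>\<^sup>+z. h z \<partial>distr M ?P (Z i))"
      by (rule nn_integral_distr[OF Zi, symmetric]) (use h in simp)
    also have "\<dots> = (\<integral>\<^sup>+z. h z \<partial>?P)" by (simp only: Zlaw)
    also have "\<dots> = emeasure (?N \<Otimes>\<^sub>M ?P) E"
      unfolding h_def by (rule NP.emeasure_pair_measure_alt2[OF E, symmetric])
    also have "\<dots> = emeasure (distr (?N \<Otimes>\<^sub>M ?P) ?B ?F) B"
      unfolding E_def by (rule emeasure_distr[OF F B, symmetric])
    finally show "emeasure (distr M ?B (X i)) B = emeasure (distr (?N \<Otimes>\<^sub>M ?P) ?B ?F) B" .
  qed simp
qed

text \<open>Independence of the \<open>X i\<close> makes the joint law a power of the marginal law.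
  Reading \<open>distr_pair_PiM\<close> from right to left regroups it into a family of scalars
  independent of a family of vectors, so that the scalars can be frozen.\<close>

lemma mixed_normal_sample_joint_law:
  assumes M: "prob_space M" and sample: "mixed_normal_sample M d n Z X" and n: "n \<ge> 1"
  shows "distr M (Pi\<^sub>M {1..n} (\<lambda>_. borel_vec d)) (\<lambda>\<omega>. \<lambda>i\<in>{1..n}. X i \<omega>) =
    distr (std_normal_PiM {1..n} \<Otimes>\<^sub>M Pi\<^sub>M {1..n} (\<lambda>_. std_normal_PiM {..<d}))
      (Pi\<^sub>M {1..n} (\<lambda>_. borel_vec d)) (\<lambda>(x, y). \<lambda>i\<in>{1..n}. (\<lambda>(e, z). \<lambda>j\<in>{..<d}. e * z j) (x i, y i))"
proof -
  interpret M: prob_space M by fact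
  have X: "X i \<in> M \<rightarrow>\<^sub>M borel_vec d" if "i \<in> {1..n}" for i
    using sample that unfolding mixed_normal_sample_def has_cond_law_def by blast
  have ind: "M.indep_vars (\<lambda>_. borel_vec d) X {1..n}"
    using sample unfolding mixed_normal_sample_def iid_vars_def by blast
  have "distr M (Pi\<^sub>M {1..n} (\<lambda>_. borel_vec d)) (\<lambda>\<omega>. \<lambda>i\<in>{1..n}. X i \<omega>) =
      Pi\<^sub>M {1..n} (\<lambda>i. distr M (borel_vec d) (X i))"
    using ind n X by (subst (asm) M.indep_vars_iff_distr_eq_PiM') auto
  also have "\<dots> = Pi\<^sub>M {1..n} (\<lambda>_. distr (std_normal_distribution \<Otimes>\<^sub>M std_normal_PiM {..<d}) (borel_vec d)
      (\<lambda>(e, z). \<lambda>j\<in>{..<d}. e * z j))"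
    by (rule PiM_cong[OF refl]) (rule mixed_normal_sample_law[OF M sample])
  also note distr_pair_PiM[OF _ std_normal.prob_space_axioms prob_space_std_normal_PiM measurable_scale_vec,
      of "{1..n}", symmetric]
  finally show ?thesis by simp
qed

section \<open>Distribution functions of the squared norms\<close>

lemma vec_norm_square: "(vec_norm d x)\<^sup>2 = (\<Sum>j<d. (x j)\<^sup>2)"
  by (simp add: vec_norm_def L2_set_def sum_nonneg)

lemma measurable_vec_component:
  assumes "j < d"
  shows "(\<lambda>x. x j) \<in> borel_measurable (borel_vec d)"
  unfolding borel_vec_def using assms by (intro measurable_component_singleton) simp

lemma measurable_vec_norm_square: "(\<lambda>x. (vec_norm d x)\<^sup>2) \<in> borel_measurable (borel_vec d)"
  unfolding vec_norm_square
  by (intro borel_measurable_sum borel_measurable_power measurable_vec_component) simp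

lemma measurable_normalized_sum:
  assumes "\<And>i. i \<in> {1..n} \<Longrightarrow> X i \<in> M \<rightarrow>\<^sub>M borel_vec d"
  shows "normalized_sum d n X \<in> M \<rightarrow>\<^sub>M borel_vec d"
  unfolding normalized_sum_def
  by (subst borel_vec_def, intro measurable_restrict borel_measurable_divide borel_measurable_sum
      measurable_compose[OF assms measurable_vec_component]) auto

lemma mixed_normal_sample_measurable:
  "mixed_normal_sample M d n Z X \<Longrightarrow> i \<in> {1..n} \<Longrightarrow> X i \<in> M \<rightarrow>\<^sub>M borel_vec d"
  unfolding mixed_normal_sample_def has_cond_law_def by blast

text \<open>Conditioning on the scalars is Fubini on the regrouped product. For frozen \<eta> the
  sum is distributed as a standard normal vector \<open>w\<close> scaled by the Euclidean norm of
  \<eta>, and dividing its squared norm by \<open>n\<close> leaves \<open>V \<eta>\<close> times the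
  squared norm of \<open>w\<close>.\<close>

lemma mixed_normal_sample_sq_norm_cdf:
  assumes M: "prob_space M" and sample: "mixed_normal_sample M d n Z X" and n: "n \<ge> 1"
  defines "V \<equiv> \<lambda>\<eta>. (\<Sum>i=1..n. (\<eta> i)\<^sup>2) / n"
  shows "(\<lambda>\<eta>. scaled_sq_norm_cdf {..<d} x (V \<eta>)) \<in> borel_measurable (std_normal_PiM {1..n})"
    and "measure M {\<omega> \<in> space M. (vec_norm d (normalized_sum d n X \<omega>))\<^sup>2 \<le> x} =
         (\<integral>\<eta>. scaled_sq_norm_cdf {..<d} x (V \<eta>) \<partial>std_normal_PiM {1..n})"
proof -
  let ?H = "std_normal_PiM {1..n}" and ?P = "std_normal_PiM {..<d}" and ?K = "Pi\<^sub>M {1..n} (\<lambda>_. borel_vec d)"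
  let ?Q = "Pi\<^sub>M {1..n} (\<lambda>_. ?P)"
  let ?XX = "\<lambda>\<omega>. \<lambda>i\<in>{1..n}. X i \<omega>"
  let ?FF = "\<lambda>(x, y). \<lambda>i\<in>{1..n}. (\<lambda>(e, z). \<lambda>j\<in>{..<d}. e * z j) (x i, y i)"
  let ?g = "\<lambda>\<eta>. scaled_sq_norm_cdf {..<d} x (V \<eta>)"
  interpret M: prob_space M by fact
  interpret P: prob_space ?P by (rule prob_space_std_normal_PiM)
  interpret Q: prob_space ?Q by (rule prob_space_PiM) (rule prob_space_std_normal_PiM)
  interpret H: prob_space ?H by (rule prob_space_std_normal_PiM)
  have XX: "?XX \<in> M \<rightarrow>\<^sub>M ?K"
    using mixed_normal_sample_measurable[OF sample] by (rule measurable_restrict)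
  \<comment> \<open>The event in terms of the individual vectors; \<open>B\<close> below is the
    corresponding event in terms of their sum.\<close>
  define E where "E = {y \<in> space ?K. (\<Sum>j<d. (\<Sum>i=1..n. y i j)\<^sup>2 / n) \<le> x}"
  have E: "E \<in> sets ?K"
  proof -
    have "(\<lambda>y. y i j) \<in> borel_measurable ?K" if "i \<in> {1..n}" "j < d" for i j
      using measurable_compose[OF measurable_component_singleton[OF that(1)] measurable_vec_component[OF that(2)]] .
    then have "(\<lambda>y. \<Sum>j<d. (\<Sum>i=1..n. y i j)\<^sup>2 / n) \<in> borel_measurable ?K"
      by (intro borel_measurable_sum borel_measurable_divide borel_measurable_power) auto
    then show ?thesis unfolding E_def by measurable
  qed
  have FF: "?FF \<in> ?H \<Otimes>\<^sub>M ?Q \<rightarrow>\<^sub>M ?K"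
  proof -
    note measurable_scale_vec[of d, measurable]
    show ?thesis by measurable
  qed
  define B where "B = {w \<in> space ?P. (\<Sum>j<d. (w j)\<^sup>2 / n) \<le> x}"
  have B: "B \<in> sets ?P"
  proof -
    have "(\<lambda>w. \<Sum>j<d. (w j)\<^sup>2 / n) \<in> borel_measurable ?P"
      by (intro borel_measurable_sum borel_measurable_divide borel_measurable_power
          measurable_std_normal_PiM_component) auto
    then show ?thesis unfolding B_def by measurable
  qed
  let ?E = "?FF -` E \<inter> space (?H \<Otimes>\<^sub>M ?Q)"
  have E': "?E \<in> sets (?H \<Otimes>\<^sub>M ?Q)" by (rule measurable_sets[OF FF E])
  have slice: "emeasure ?Q (Pair \<eta> -` ?E) = ennreal (?g \<eta>)" if \<eta>: "\<eta> \<in> space ?H" for \<eta>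
  proof -
    let ?T = "\<lambda>z. \<lambda>j\<in>{..<d}. \<Sum>i\<in>{1..n}. \<eta> i * z i j"
    let ?s = "sqrt (\<Sum>i\<in>{1..n}. (\<eta> i)\<^sup>2)"
    have T: "?T \<in> ?Q \<rightarrow>\<^sub>M ?P"
      by (intro measurable_into_std_normal_PiM borel_measurable_sum borel_measurable_times
          measurable_PiM_std_normal_PiM_component) auto
    have S: "(\<lambda>w. \<lambda>j\<in>{..<d}. ?s * w j) \<in> ?P \<rightarrow>\<^sub>M ?P"
      by (intro measurable_into_std_normal_PiM borel_measurable_times
          measurable_std_normal_PiM_component) auto
    have "Pair \<eta> -` ?E = ?T -` B \<inter> space ?Q"
    proof (rule set_eqI)
      fix y
      show "y \<in> Pair \<eta> -` ?E \<longleftrightarrow> y \<in> ?T -` B \<inter> space ?Q"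
      proof (cases "y \<in> space ?Q")
        case True
        then have p: "(\<eta>, y) \<in> space (?H \<Otimes>\<^sub>M ?Q)" using \<eta> by (simp add: space_pair_measure)
        have "(\<Sum>j<d. (\<Sum>i=1..n. ?FF (\<eta>, y) i j)\<^sup>2 / n) = (\<Sum>j<d. (?T y j)\<^sup>2 / n)"
          by (intro sum.cong refl) simp
        then show ?thesis
          using p True measurable_space[OF FF p] measurable_space[OF T True]
          unfolding E_def B_def by (simp only: vimage_eq Int_iff mem_Collect_eq simp_thms)
      next
        case False
        then show ?thesis by (simp add: space_pair_measure)
      qed
    qed
    then have "emeasure ?Q (Pair \<eta> -` ?E) = emeasure (distr ?Q ?P ?T) B"
      by (simp only: emeasure_distr[OF T B])
    also have "distr ?Q ?P ?T = distr ?P ?P (\<lambda>w. \<lambda>j\<in>{..<d}. ?s * w j)"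
      by (rule distr_PiM_std_normal_PiM_linear) auto
    also have "emeasure \<dots> B = emeasure ?P {w \<in> space ?P. V \<eta> * (\<Sum>j\<in>{..<d}. (w j)\<^sup>2) \<le> x}"
    proof -
      have "(\<lambda>w. \<lambda>j\<in>{..<d}. ?s * w j) -` B \<inter> space ?P = {w \<in> space ?P. V \<eta> * (\<Sum>j\<in>{..<d}. (w j)\<^sup>2) \<le> x}"
        using measurable_space[OF S] unfolding B_def V_def
        by (auto simp: power_mult_distrib sum_nonneg sum_distrib_left)
      then show ?thesis by (simp only: emeasure_distr[OF S B])
    qed
    finally show ?thesis by (simp only: scaled_sq_norm_cdf_def P.emeasure_eq_measure)
  qed
  \<comment> \<open>Measurability in \<eta> is inherited from the measures of the slices, without
    any regularity of the distribution function in \<open>v\<close>.\<close>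
  have "(\<lambda>\<eta>. enn2real (emeasure ?Q (Pair \<eta> -` ?E))) \<in> borel_measurable ?H"
    using Q.measurable_emeasure_Pair[OF E'] by measurable
  then show g: "?g \<in> borel_measurable ?H"
    by (rule measurable_cong[THEN iffD1, rotated]) (simp only: slice enn2real_ennreal scaled_sq_norm_cdf_bounds)
  have "(\<Sum>i=1..n. X i \<omega> j / sqrt n)\<^sup>2 = (\<Sum>i=1..n. X i \<omega> j)\<^sup>2 / n" for \<omega> j
    by (simp add: power_divide flip: sum_divide_distrib)
  then have "{\<omega> \<in> space M. (vec_norm d (normalized_sum d n X \<omega>))\<^sup>2 \<le> x} = ?XX -` E \<inter> space M"
    using measurable_space[OF XX] unfolding E_def
    by (auto simp: vec_norm_square normalized_sum_def power_divide)
  then have "measure M {\<omega> \<in> space M. (vec_norm d (normalized_sum d n X \<omega>))\<^sup>2 \<le> x} = measure (distr M ?K ?XX) E"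
    by (simp only: measure_distr[OF XX E])
  also have "\<dots> = measure (?H \<Otimes>\<^sub>M ?Q) ?E"
    unfolding mixed_normal_sample_joint_law[OF M sample n] by (rule measure_distr[OF FF E])
  also have "\<dots> = enn2real (\<integral>\<^sup>+\<eta>. ennreal (?g \<eta>) \<partial>?H)"
    unfolding measure_def Q.emeasure_pair_measure_alt[OF E']
    by (rule arg_cong[where f=enn2real], rule nn_integral_cong) (rule slice)
  also have "\<dots> = (\<integral>\<eta>. ?g \<eta> \<partial>?H)"
    using g by (intro integral_eq_nn_integral[symmetric]) (auto simp: scaled_sq_norm_cdf_bounds)
  finally show "measure M {\<omega> \<in> space M. (vec_norm d (normalized_sum d n X \<omega>))\<^sup>2 \<le> x} = (\<integral>\<eta>. ?g \<eta> \<partial>?H)" .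
qed

lemma std_normal_vec_sq_norm_cdf:
  assumes "has_law N (borel_vec d) Z (std_normal_vec d)"
  shows "measure N {\<omega> \<in> space N. (vec_norm d (Z \<omega>))\<^sup>2 \<le> x} = scaled_sq_norm_cdf {..<d} x 1"
proof -
  let ?B = "{w \<in> space (borel_vec d). (vec_norm d w)\<^sup>2 \<le> x}"
  have Z: "Z \<in> N \<rightarrow>\<^sub>M borel_vec d" and law: "distr N (borel_vec d) Z = std_normal_PiM {..<d}"
    using assms by (simp_all add: has_law_def std_normal_vec_eq)
  have B: "?B \<in> sets (borel_vec d)" using measurable_vec_norm_square by measurable
  have "{\<omega> \<in> space N. (vec_norm d (Z \<omega>))\<^sup>2 \<le> x} = Z -` ?B \<inter> space N"
    using measurable_space[OF Z] by auto
  then have "measure N {\<omega> \<in> space N. (vec_norm d (Z \<omega>))\<^sup>2 \<le> x} = measure (std_normal_PiM {..<d}) ?B"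
    by (simp add: measure_distr[OF Z B] flip: law)
  then show ?thesis
    using sets_eq_imp_space_eq[OF sets_std_normal_PiM[of d]]
    by (simp add: scaled_sq_norm_cdf_def vec_norm_square)
qed

text \<open>Insert \<open>v = V\<close> in the expansion and integrate: the mean of \<open>V\<close>
  is 1, so the linear term drops out, and its variance \<open>2 / n\<close> turns
  \<open>4 d E (V - 1)^2\<close> into \<open>8 d / n\<close>.\<close>

lemma kolmogorov_sq_norm_le:
  assumes M: "prob_space M" and sample: "mixed_normal_sample M d n Z X"
    and n: "n \<ge> 1" and d: "d \<ge> 1"
  shows "\<bar>measure M {\<omega> \<in> space M. (vec_norm d (normalized_sum d n X \<omega>))\<^sup>2 \<le> x} -
          scaled_sq_norm_cdf {..<d} x 1\<bar> \<le> 8 * real d / real n"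
proof -
  define I where "I = {1..n}"
  let ?H = "std_normal_PiM I" and ?q = "centered_square_sum I" and ?g = "scaled_sq_norm_cdf {..<d} x"
  define V where "V = (\<lambda>\<eta>::nat\<Rightarrow>real. (\<Sum>i\<in>I. (\<eta> i)\<^sup>2) / n)"
  have I: "finite I" "card I = n" by (simp_all add: I_def)
  interpret H: prob_space ?H by (rule prob_space_std_normal_PiM)
  have S: "(\<lambda>\<eta>. ?g (V \<eta>)) \<in> borel_measurable ?H"
    "measure M {\<omega> \<in> space M. (vec_norm d (normalized_sum d n X \<omega>))\<^sup>2 \<le> x} = (\<integral>\<eta>. ?g (V \<eta>) \<partial>?H)"
    unfolding V_def I_def by (rule mixed_normal_sample_sq_norm_cdf[OF M sample n])+
  note q = centered_square_sum_moments[OF I(1), unfolded I(2)]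
  \<comment> \<open>The centered square sum now runs over the sample indices, and its moments give
    the mean and variance of \<open>V\<close>.\<close>
  have V: "V \<eta> - 1 = ?q \<eta> / n" for \<eta>
    using n I by (simp add: V_def centered_square_sum_def sum_subtractf diff_divide_distrib)
  have V0: "V \<eta> \<ge> 0" for \<eta> by (simp add: V_def sum_nonneg)
  have "{..<d} \<noteq> {}" using d by (simp add: lessThan_empty_iff)
  then obtain c :: real where c: "\<And>v::real. v \<ge> 0 \<Longrightarrow> \<bar>?g v - ?g 1 - (v - 1) * c\<bar> \<le> 4 * d * (v - 1)\<^sup>2"
    using scaled_sq_norm_cdf_taylor[of "{..<d}" x] by auto
  have gi: "integrable ?H (\<lambda>\<eta>. ?g (V \<eta>))"
    using S(1) by (intro H.integrable_const_bound[where B=1]) (auto simp: scaled_sq_norm_cdf_bounds)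
  have qi: "integrable ?H (\<lambda>\<eta>. ?q \<eta> / n * c)" using q(1) by simp
  have ri: "integrable ?H (\<lambda>\<eta>. ?g (V \<eta>) - ?g 1 - (V \<eta> - 1) * c)"
    unfolding V using gi qi by (intro Bochner_Integration.integrable_diff) auto
  have "(\<integral>\<eta>. ?g (V \<eta>) - ?g 1 - (V \<eta> - 1) * c \<partial>?H) =
      (\<integral>\<eta>. ?g (V \<eta>) \<partial>?H) - ?g 1 - (\<integral>\<eta>. ?q \<eta> / n * c \<partial>?H)"
    unfolding V using gi qi by (simp add: H.prob_space)
  also have "(\<integral>\<eta>. ?q \<eta> / n * c \<partial>?H) = 0" using q(2) by simp
  finally have "\<bar>(\<integral>\<eta>. ?g (V \<eta>) \<partial>?H) - ?g 1\<bar> = \<bar>\<integral>\<eta>. ?g (V \<eta>) - ?g 1 - (V \<eta> - 1) * c \<partial>?H\<bar>"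
    by (simp only: diff_zero)
  also have "\<dots> \<le> (\<integral>\<eta>. \<bar>?g (V \<eta>) - ?g 1 - (V \<eta> - 1) * c\<bar> \<partial>?H)"
    by (rule integral_abs_bound)
  also have "\<dots> \<le> (\<integral>\<eta>. 4 * d * (V \<eta> - 1)\<^sup>2 \<partial>?H)"
  proof (rule integral_mono)
    show "integrable ?H (\<lambda>\<eta>. \<bar>?g (V \<eta>) - ?g 1 - (V \<eta> - 1) * c\<bar>)" using ri by (rule integrable_abs)
    show "integrable ?H (\<lambda>\<eta>. 4 * d * (V \<eta> - 1)\<^sup>2)" unfolding V power_divide using q(3) by simp
  qed (rule c[OF V0])
  also have "\<dots> = 8 * real d / real n"
    unfolding V power_divide using q(4) n by (simp add: power2_eq_square[of "real n"])
  finally show ?thesis by (simp only: S(2))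
qed

subsection \<open>Distances\<close>

text \<open>Every positive \<epsilon> that is at least \<open>D\<close> is admissible, because
  \<open>G\<close> is monotone. Nonnegativity is recorded because the final order bound concerns an
  absolute value.\<close>

lemma levy_dist_le:
  assumes MN: "prob_space M" "prob_space N" and X: "X \<in> borel_measurable M" and Y: "Y \<in> borel_measurable N"
    and le: "\<And>x. \<bar>measure M {\<omega> \<in> space M. X \<omega> \<le> x} - measure N {\<omega> \<in> space N. Y \<omega> \<le> x}\<bar> \<le> D"
  shows "0 \<le> levy_dist M X N Y" "levy_dist M X N Y \<le> D"
proof -
  define F where "F = cdf (distr M borel X)"
  define G where "G = cdf (distr N borel Y)"
  define A where "A = {\<epsilon>::real. \<epsilon> > 0 \<and> (\<forall>x. G (x - \<epsilon>) - \<epsilon> \<le> F x \<and> F x \<le> G (x + \<epsilon>) + \<epsilon>)}"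
  have L: "levy_dist M X N Y = Inf A"
    by (simp add: levy_dist_def A_def F_def G_def Let_def)
  interpret N: real_distribution "distr N borel Y" using MN Y by (intro real_distribution_distr)
  have FG: "\<bar>F x - G x\<bar> \<le> D" for x
  proof -
    have "X -` {..x} \<inter> space M = {\<omega> \<in> space M. X \<omega> \<le> x}" "Y -` {..x} \<inter> space N = {\<omega> \<in> space N. Y \<omega> \<le> x}"
      by auto
    then show ?thesis using le[of x] X Y by (simp add: F_def G_def cdf_def measure_distr)
  qed
  have D0: "D \<ge> 0" using FG[of 0] by linarith
  have mem: "\<epsilon> \<in> A" if "\<epsilon> > 0" "\<epsilon> \<ge> D" for \<epsilon>
    unfolding A_def
  proof (intro CollectI conjI allI)
    fix x
    have "G (x - \<epsilon>) \<le> G x" "G x \<le> G (x + \<epsilon>)"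
      unfolding G_def using that by (auto intro!: N.cdf_nondecreasing)
    then show "G (x - \<epsilon>) - \<epsilon> \<le> F x" "F x \<le> G (x + \<epsilon>) + \<epsilon>" using FG[of x] that by linarith+
  qed (use that in simp)
  have bdd: "bdd_below A" by (rule bdd_belowI[of _ 0]) (simp add: A_def)
  have "A \<noteq> {}" using mem[of "D + 1"] D0 by auto
  then show "0 \<le> levy_dist M X N Y" unfolding L by (rule cInf_greatest) (simp add: A_def)
  show "levy_dist M X N Y \<le> D"
  \<comment> \<open>\<open>D\<close> may be 0 and then is not admissible itself, so the bound is
    reached through \<open>D + e\<close>.\<close>
  proof (rule field_le_epsilon)
    fix e :: real assume "e > 0"
    then show "levy_dist M X N Y \<le> D + e"
      unfolding L using D0 by (intro cInf_lower bdd mem) auto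
  qed
qed

text \<open>A sublevel set of the squared norm is a ball of radius \<open>sqrt x\<close> about the
  origin, or empty if \<open>x\<close> is negative.\<close>

lemma abs_diff_measure_ball_le_ball_dist:
  assumes MN: "prob_space M" "prob_space N"
  shows "\<bar>measure M {\<omega> \<in> space M. (vec_norm d (X \<omega>))\<^sup>2 \<le> x} - measure N {\<omega> \<in> space N. (vec_norm d (Y \<omega>))\<^sup>2 \<le> x}\<bar>
    \<le> ball_dist d M X N Y"
proof -
  interpret M: prob_space M by fact
  interpret N: prob_space N by fact
  define f where "f = (\<lambda>(r::real, t).
    \<bar>measure M {\<omega> \<in> space M. vec_norm d (\<lambda>j. X \<omega> j - t j) \<le> r} -
     measure N {\<omega> \<in> space N. vec_norm d (\<lambda>j. Y \<omega> j - t j) \<le> r}\<bar>)"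
  let ?I = "{0..} \<times> space (borel_vec d)"
  have bd: "\<bar>measure M A - measure N B\<bar> \<le> 1" for A B
    using M.prob_le_1[of A] N.prob_le_1[of B] measure_nonneg[of M A] measure_nonneg[of N B] by linarith
  \<comment> \<open>A supremum of reals dominates its terms only if the family is bounded;
    differences of probabilities are.\<close>
  have "bdd_above (f ` ?I)"
    by (rule bdd_aboveI[of _ 1]) (use bd in \<open>auto simp: f_def\<close>)
  then have le: "f p \<le> ball_dist d M X N Y" if "p \<in> ?I" for p
    unfolding ball_dist_def f_def[symmetric] using that by (rule cSUP_upper[rotated])
  \<comment> \<open>Centers range over \<open>space (borel_vec d)\<close>, so the origin has to be
    \<open>undefined\<close> off \<open>{..<d}\<close>; the norm does not see those
    coordinates.\<close>
  define o0 where "o0 = (\<lambda>j\<in>{..<d}. 0 :: real)"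
  have o0: "o0 \<in> space (borel_vec d)" by (auto simp: borel_vec_def space_PiM o0_def)
  have vn: "vec_norm d (\<lambda>j. y j - o0 j) = vec_norm d y" for y
    by (auto simp: vec_norm_def o0_def intro!: L2_set_cong)
  have vn0: "vec_norm d y \<ge> 0" for y by (simp add: vec_norm_def)
  show ?thesis
  proof (cases "x \<ge> 0")
    case True
    then have sq: "(vec_norm d y)\<^sup>2 \<le> x \<longleftrightarrow> vec_norm d y \<le> sqrt x" for y
      using vn0[of y] by (metis real_sqrt_le_iff real_sqrt_unique)
    show ?thesis using le[of "(sqrt x, o0)"] True o0 by (simp add: f_def vn sq)
  next
    case False
    then have no: "\<not> (vec_norm d y)\<^sup>2 \<le> x" for y using zero_le_power2[of "vec_norm d y"] by linarith
    \<comment> \<open>Both events are empty, and any single term shows that the supremum is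
      nonnegative.\<close>
    have "0 \<le> ball_dist d M X N Y" using le[of "(0, o0)"] o0 unfolding f_def by force
    then show ?thesis by (simp add: no)
  qed
qed

theorem proposition4p1:
  fixes d :: "nat \<Rightarrow> nat"
    and M :: "nat \<Rightarrow> 'a measure"
    and Zs X :: "nat \<Rightarrow> nat \<Rightarrow> 'a \<Rightarrow> nat \<Rightarrow> real"
    and N :: "nat \<Rightarrow> 'b measure"
    and Z :: "nat \<Rightarrow> 'b \<Rightarrow> nat \<Rightarrow> real"
    and S :: "nat \<Rightarrow> 'a \<Rightarrow> nat \<Rightarrow> real"
  assumes dim: "\<And>n. n \<ge> 1 \<Longrightarrow> d n \<ge> 1"
    and prob_M: "\<And>n. n \<ge> 1 \<Longrightarrow> prob_space (M n)"
    and prob_N: "\<And>n. n \<ge> 1 \<Longrightarrow> prob_space (N n)"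
    and sample: "\<And>n. n \<ge> 1 \<Longrightarrow> mixed_normal_sample (M n) (d n) n (Zs n) (X n)"
    and normal: "\<And>n. n \<ge> 1 \<Longrightarrow> has_law (N n) (borel_vec (d n)) (Z n) (std_normal_vec (d n))"
    and S_def: "\<And>n. S n = normalized_sum (d n) n (X n)"
    and d_lim: "filterlim d at_top sequentially"
    and ratio_lim: "(\<lambda>n. real (d n) / real n) \<longlonglongrightarrow> 0"
  shows "(\<forall>n\<ge>1. ball_dist (d n) (M n) (S n) (N n) (Z n) \<ge>
            levy_dist (M n) (\<lambda>\<omega>. (vec_norm (d n) (S n \<omega>))\<^sup>2) (N n) (\<lambda>\<omega>. (vec_norm (d n) (Z n \<omega>))\<^sup>2)) \<and>
         (\<lambda>n. levy_dist (M n) (\<lambda>\<omega>. (vec_norm (d n) (S n \<omega>))\<^sup>2) (N n) (\<lambda>\<omega>. (vec_norm (d n) (Z n \<omega>))\<^sup>2))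
           \<in> O(\<lambda>n. real (d n) powr (3/2) / real n)"
proof -
  let ?X = "\<lambda>n \<omega>. (vec_norm (d n) (S n \<omega>))\<^sup>2" and ?Y = "\<lambda>n \<omega>. (vec_norm (d n) (Z n \<omega>))\<^sup>2"
  have X: "?X n \<in> borel_measurable (M n)" if "n \<ge> 1" for n
    unfolding S_def
    by (rule measurable_compose[OF measurable_normalized_sum measurable_vec_norm_square])
       (rule mixed_normal_sample_measurable[OF sample[OF that]])
  have Y: "?Y n \<in> borel_measurable (N n)" if "n \<ge> 1" for n
    using normal[OF that] by (intro measurable_compose[OF _ measurable_vec_norm_square]) (simp add: has_law_def)
  \<comment> \<open>Here the ball distance itself serves as the uniform bound
    \<open>D\<close>.\<close>
  have "levy_dist (M n) (?X n) (N n) (?Y n) \<le> ball_dist (d n) (M n) (S n) (N n) (Z n)" if n: "n \<ge> 1" for n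
    using prob_M[OF n] prob_N[OF n] X[OF n] Y[OF n] by (rule levy_dist_le(2))
       (rule abs_diff_measure_ball_le_ball_dist[OF prob_M[OF n] prob_N[OF n]])
  moreover have "(\<lambda>n. levy_dist (M n) (?X n) (N n) (?Y n)) \<in> O(\<lambda>n. real (d n) powr (3/2) / real n)"
  proof (rule bigoI[of _ 8], rule eventually_sequentiallyI[of 1])
    fix n :: nat assume n: "n \<ge> 1"
    note levy = levy_dist_le[OF prob_M[OF n] prob_N[OF n] X[OF n] Y[OF n], of "8 * real (d n) / real n"]
    have le: "\<bar>measure (M n) {\<omega> \<in> space (M n). ?X n \<omega> \<le> x} - measure (N n) {\<omega> \<in> space (N n). ?Y n \<omega> \<le> x}\<bar> \<le> 8 * real (d n) / real n" for x
      unfolding S_def std_normal_vec_sq_norm_cdf[OF normal[OF n]]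
      by (rule kolmogorov_sq_norm_le[OF prob_M[OF n] sample[OF n] n dim[OF n]])
    \<comment> \<open>The bound \<open>8 d / n\<close> is stronger than required;
      \<open>d \<ge> 1\<close> weakens it to the stated power.\<close>
    have "real (d n) powr 1 \<le> real (d n) powr (3/2)"
      using dim[OF n] by (intro powr_mono) auto
    then have "8 * real (d n) / real n \<le> 8 * (real (d n) powr (3/2) / real n)"
      using n dim[OF n] by (simp add: divide_right_mono)
    then show "norm (levy_dist (M n) (?X n) (N n) (?Y n)) \<le> 8 * norm (real (d n) powr (3/2) / real n)"
      using levy[OF le] by simp
  qed
  ultimately show ?thesis by blast
qed

end
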